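(* Let $H$ be a graph and $v$ a vertex of $H$. Set $h=|E(H-v)|$, and let $\alpha$ be the number of isolated vertices of $H-v$. Then for every graph $G$ that does not contain $H$ as a minor and every positive integer $r$, we have \[ \mathrm{col}_r(G)\le h\cdot(2r+1)+\alpha . \]
   Context: All graphs are finite, undirected and simple. For a linear order $L$ of $V(G)$ and vertices $u,v$, $u$ is strongly $r$-reachable from $v$ with respect to $L$ if there is a path of length $\ell$, $0\le \ell\le r$, between $u$ and $v$ such that $u\le_L v$ and every inner vertex $w$ of the path satisfies $v<_L w$. Let $\mathrm{SReach}_r[G,L,v]$ be the set of vertices strongly $r$-reachable from $v$ (it contains $v$). The $r$-colouring number is $\mathrm{col}_r(G)=\min_{L}\max_{v\in V(G)}|\mathrm{SReach}_r[G,L,v]|$, the minimum over all linear orders $L$ of $V(G)$. *)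

theory Defs
  imports "Graph_Theory.Graph_Theory" "HOL-Library.Disjoint_Sets"
begin

text \<open>
  Finite simple undirected graphs are the locale \<open>graph\<close> of the Graph Theory entry: finite digraphs
  without loops and parallel arcs whose arc relation is symmetric. An undirected edge thus
  corresponds to two opposite arcs, and \<open>u \<rightarrow>\<^bsub>G\<^esub> w\<close> is adjacency. The graph without vertices
  is included.
\<close>

text \<open>Counted as unordered pairs, so that the two arcs of an edge are not counted twice.\<close>

definition edges :: "('a, 'b) pre_digraph \<Rightarrow> 'a set set" where
  "edges G = {{u, w} | u w. u \<rightarrow>\<^bsub>G\<^esub> w}"

definition isolated_verts :: "('a, 'b) pre_digraph \<Rightarrow> 'a set" where
  "isolated_verts G = {u \<in> verts G. \<not> (\<exists>w. u \<rightarrow>\<^bsub>G\<^esub> w)}"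

text \<open>
  \<open>is_minor H G\<close>: \<open>H\<close> is a minor of \<open>G\<close>, witnessed by branch sets \<open>B x\<close>. They are nonempty because
  \<open>connected\<close> fails for the graph without vertices.
\<close>

definition is_minor :: "('c, 'd) pre_digraph \<Rightarrow> ('a, 'b) pre_digraph \<Rightarrow> bool" where
  "is_minor H G \<longleftrightarrow>
    (\<exists>B :: 'c \<Rightarrow> 'a set.
      (\<forall>x \<in> verts H. B x \<subseteq> verts G \<and> connected (G \<restriction> B x)) \<and>
      disjoint_family_on B (verts H) \<and>
      (\<forall>x y. x \<rightarrow>\<^bsub>H\<^esub> y \<longrightarrow> (\<exists>a \<in> B x. \<exists>b \<in> B y. a \<rightarrow>\<^bsub>G\<^esub> b)))"

text \<open>
  Linear orders are relations, with \<open>(x, y) \<in> L\<close> meaning that \<open>x\<close> is at most \<open>y\<close>. The inner vertices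
  of the path \<open>p\<close> from \<open>v\<close> to \<open>u\<close>, given as its list of vertices, are those in \<open>butlast (tl p)\<close>.
\<close>

definition SReach :: "nat \<Rightarrow> ('a, 'b) pre_digraph \<Rightarrow> 'a rel \<Rightarrow> 'a \<Rightarrow> 'a set" where
  "SReach r G L v =
    {u \<in> verts G. (u, v) \<in> L \<and>
      (\<exists>p. vpath p G \<and> hd p = v \<and> last p = u \<and> vwalk_length p \<le> r \<and>
        (\<forall>w \<in> set (butlast (tl p)). (v, w) \<in> L \<and> v \<noteq> w))}"

text \<open>
  The supremum of a finite nonempty set of natural numbers is its maximum; that of the empty set
  is \<open>0\<close>, so the graph without vertices has colouring number \<open>0\<close>.
\<close>

definition col :: "nat \<Rightarrow> ('a, 'b) pre_digraph \<Rightarrow> nat" where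
  "col r G = Min {SUP v \<in> verts G. card (SReach r G L v) | L. linear_order_on (verts G) L}"

end

theory Submission
  imports Defs
begin

text \<open>
  As in Andreae's bound on the cop number, the order is built by removing one path at a time, each
  of them shortest inside the current component \<open>C\<close> of the remaining graph. Each edge of \<open>H - v\<close> is
  realised by at most one of these paths, and an edge whose path is no longer needed to cover the
  vertices attached to \<open>C\<close> is forgotten. So the attached vertices always lie on at most \<open>h\<close> paths
  and \<open>\<alpha>\<close> single vertices. A vertex of \<open>C\<close> reaches at most \<open>2 * r + 1\<close> vertices of such a path,
  because two reached vertices are joined through \<open>C\<close> by a walk of length at most \<open>2 * r\<close>. If all
  edges and isolated vertices of \<open>H - v\<close> are realised, then the paths can be cut between their two
  ends so that, with \<open>C\<close> in the role of \<open>v\<close>, a model of \<open>H\<close> appears. The only obstacle is a leaf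
  edge whose path is attached in a single vertex; it counts for much less than \<open>2 * r + 1\<close>, which
  leaves room to remove one more vertex.
\<close>

section \<open>Choosing an incident edge at every vertex\<close>

text \<open>The set \<open>C\<close>, in the role of v, has to touch every branch set, so each end x
  of an edge of H - v needs an attached vertex on one of its paths; an edge chosen at x supplies it.
  In a component of H - v with a cycle, every vertex can get an edge of its own. A tree has one edge
  too few: some edge must serve both of its ends, which takes two attached vertices on its path. A
  leaf edge with two such vertices can do this, so leaf edges with only one are the sole obstacle.
  An edge serving one end is cut at a private attached vertex, one on no other path. It exists
  because edges are forgotten until the covering is minimal. Forgetting also means that the number
  of realised edges need not grow; what decreases is the number of unordered vertices. Accounting:
  as long as an edge is unrealised, old paths use at most h - 1 shares of 2r + 1, and a vertex of
  the next path sees at most 2r + 1 vertices of that path, itself included. The last share pays for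
  this, so the order inside a removed path can be arbitrary.\<close>

lemma nonrepeating_choice:
  fixes F :: "'c rel" and D :: "'c \<Rightarrow> 'c \<Rightarrow> bool"
  assumes fin: "finite F" and F_sym: "sym F" and irr: "\<And>x. (x, x) \<notin> F" and D_sym: "\<And>x y. D x y \<Longrightarrow> D y x"
    and leaf: "\<And>x y. (x, y) \<in> F \<Longrightarrow> (\<forall>z. (x, z) \<in> F \<longrightarrow> z = y) \<Longrightarrow> D x y"
  shows "\<exists>m. \<forall>x \<in> Field F. (x, m x) \<in> F \<and> (m (m x) = x \<longrightarrow> D x (m x))"
proof -
  \<comment> \<open>An \<open>ok\<close> set is closed under \<open>m\<close>, and the choice
    already works on it. A largest one is all of \<open>Field F\<close>: otherwise an outside
    neighbour could point into it, the ends of an outside \<open>D\<close>-edge could point at each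
    other, or an outside cycle could be followed around.\<close>
  define ok where "ok X m \<longleftrightarrow> X \<subseteq> Field F \<and>
    (\<forall>x \<in> X. (x, m x) \<in> F \<and> m x \<in> X \<and> (m (m x) = x \<longrightarrow> D x (m x)))" for X m
  have finF: "finite (Field F)" using fin by (rule finite_Field)
  have nb: "\<exists>y. (x, y) \<in> F" if "x \<in> Field F" for x
    using that F_sym by (auto simp: Field_def sym_def)
  have "\<exists>X. (\<exists>m. ok X m) \<and> (\<forall>Y. (\<exists>m. ok Y m) \<longrightarrow> card Y \<le> card X)"
    by (rule ex_has_greatest_nat[of _ "{}" card "Suc (card (Field F))"])
      (auto simp: ok_def intro!: le_imp_less_Suc card_mono finF)
  then obtain X m where X: "ok X m" and max: "\<And>Y m. ok Y m \<Longrightarrow> card Y \<le> card X"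
    by blast
  have finX: "finite X" using X finF unfolding ok_def by (blast intro: finite_subset)
  have grow: False if "ok Y m'" "X \<subset> Y" for Y m'
  proof -
    have "finite Y" using that finF unfolding ok_def by (blast intro: finite_subset)
    then show False using max[OF that(1)] psubset_card_mono[of Y X] that(2) by simp
  qed
  have closed: "x \<notin> X" if "(y, x) \<in> F" "y \<notin> X" for x y
  proof
    assume "x \<in> X"
    have "ok (insert y X) (m(y := x))"
      using X \<open>x \<in> X\<close> that unfolding ok_def by (auto intro: FieldI1)
    then show False using grow that(2) by blast
  qed
  have noD: "\<not> D y z" if "(y, z) \<in> F" "y \<notin> X" for y z
  proof
    assume d: "D y z"
    have z: "z \<notin> X" using closed that by blast
    have "(z, y) \<in> F" using F_sym that by (auto simp: sym_def)
    then have "ok (insert y (insert z X)) (m(y := z, z := y))"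
      using X z d D_sym[OF d] that unfolding ok_def by (auto intro: FieldI1 FieldI2)
    then show False using grow that(2) by blast
  qed
  have "Field F \<subseteq> X"
  proof
    fix x0 assume x0: "x0 \<in> Field F"
    show "x0 \<in> X"
    proof (rule ccontr)
      assume nx0: "x0 \<notin> X"
      define nxt where "nxt x y = (SOME z. (y, z) \<in> F \<and> z \<noteq> x)" for x y
      \<comment> \<open>Outside \<open>X\<close> no edge satisfies \<open>D\<close>, so no vertex
        there is a leaf, and a walk can always continue without turning back.\<close>
      have nxt: "(y, nxt x y) \<in> F \<and> nxt x y \<noteq> x" if "(x, y) \<in> F" "x \<notin> X" for x y
      proof -
        have yx: "(y, x) \<in> F" using that F_sym by (auto simp: sym_def)
        have "\<not> D y x" using noD closed that yx by blast
        then have "\<exists>z. (y, z) \<in> F \<and> z \<noteq> x" using leaf[OF yx] by blast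
        then show ?thesis unfolding nxt_def by (rule someI_ex)
      qed
      obtain x1 where x1: "(x0, x1) \<in> F" using nb x0 by blast
      \<comment> \<open>Pairs of consecutive vertices, since the next vertex depends on the last
        two.\<close>
      define s where "s = rec_nat (x0, x1) (\<lambda>_ p. (snd p, nxt (fst p) (snd p)))"
      have s_Suc: "s (Suc n) = (snd (s n), nxt (fst (s n)) (snd (s n)))" for n
        by (simp add: s_def)
      have s: "s n \<in> F \<and> fst (s n) \<notin> X" for n
      proof (induction n)
        case 0 then show ?case using x1 nx0 by (simp add: s_def)
      next
        case (Suc n)
        then show ?case using nxt[of "fst (s n)" "snd (s n)"] closed[of "fst (s n)" "snd (s n)"]
          by (simp add: s_Suc)
      qed
      define w where "w n = fst (s n)" for n
      have w1: "snd (s n) = w (Suc n)" for n by (simp add: w_def s_Suc)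
      have wF: "(w n, w (Suc n)) \<in> F" for n
        using s[of n] w1[of n] by (metis prod.collapse w_def)
      have wX: "w n \<notin> X" for n using s by (simp add: w_def)
      have w2: "w (Suc (Suc n)) \<noteq> w n" for n
        using nxt[of "fst (s n)" "snd (s n)"] s[of n] w1[of "Suc n"] by (simp add: w_def s_Suc)
      have "\<exists>j. \<exists>i<j. w i = w j"
      proof (rule ccontr)
        assume "\<not> ?thesis"
        then have "inj w" by (metis injI linorder_neqE_nat)
        moreover have "range w \<subseteq> Field F" using wF by (auto intro: FieldI1)
        ultimately show False using finF by (meson finite_imageD finite_subset infinite_UNIV_nat)
      qed
      then obtain j where j: "\<exists>i<j. w i = w j" and jmin: "\<And>k. k < j \<Longrightarrow> \<not> (\<exists>i<k. w i = w k)"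
        using exists_least_iff[of "\<lambda>j. \<exists>i<j. w i = w j"] by blast
      obtain i where i: "i < j" "w i = w j" using j by blast
      have inj: "inj_on w {..<j}"
        by (rule inj_onI) (metis jmin lessThan_iff linorder_neqE_nat)
      \<comment> \<open>Up to its first repetition the walk is a tail running into a cycle. Every
        vertex on it, tail included, points to its successor; injectivity below \<open>j\<close>
        makes the successor well defined.\<close>
      define m' where "m' x = (if x \<in> w ` {..<j} then w (Suc (the_inv_into {..<j} w x)) else m x)" for x
      have m'w: "m' (w t) = w (Suc t)" if "t < j" for t
        using that by (simp add: m'_def the_inv_into_f_f[OF inj])
      have m'X: "m' x = m x" if "x \<in> X" for x using that wX by (auto simp: m'_def)
      have suc_in: "w (Suc t) \<in> w ` {..<j}" if "t < j" for t
      proof (cases "Suc t = j")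
        case True then show ?thesis using i by (metis image_eqI lessThan_iff)
      next
        case False then show ?thesis using that by simp
      qed
      have m'm': "m' (m' (w t)) \<noteq> w t" if t: "t < j" for t
      proof (cases "Suc t = j")
        case True
        then have "m' (m' (w t)) = w (Suc i)" using m'w[of t] m'w[of i] t i by simp
        \<comment> \<open>The cycle has at least three vertices: two would mean turning back, one
          would be a loop.\<close>
        moreover have "Suc i \<noteq> t" using w2[of i] i True by auto
        moreover have "Suc i \<noteq> j"
        proof
          assume "Suc i = j"
          then have "(w i, w i) \<in> F" using wF[of i] i by simp
          then show False using irr by blast
        qed
        ultimately show ?thesis using inj_onD[OF inj, of "Suc i" t] i t by auto
      next
        case False
        then show ?thesis using m'w[of t] m'w[of "Suc t"] t w2[of t] by simp
      qed
      have "ok (X \<union> w ` {..<j}) m'"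
        unfolding ok_def
      proof (intro conjI ballI)
        show "X \<union> w ` {..<j} \<subseteq> Field F" using X wF unfolding ok_def by (auto intro: FieldI1)
        fix x assume x: "x \<in> X \<union> w ` {..<j}"
        consider "x \<in> X" | t where "x = w t" "t < j" using x by blast
        then have "(x, m' x) \<in> F \<and> m' x \<in> X \<union> w ` {..<j} \<and> (m' (m' x) = x \<longrightarrow> D x (m' x))"
        proof cases
          case 1 then show ?thesis using X m'X unfolding ok_def by auto
        next
          case 2 then show ?thesis using m'w wF suc_in m'm' by auto
        qed
        then show "(x, m' x) \<in> F" "m' x \<in> X \<union> w ` {..<j}" "m' (m' x) = x \<longrightarrow> D x (m' x)" by auto
      qed
      moreover have "w i \<in> w ` {..<j}" using i by blast
      ultimately show False using grow wX by blast
    qed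
  qed
  then show ?thesis using X unfolding ok_def by blast
qed

section \<open>Connected sets and geodesics\<close>

locale sym_rel =
  fixes V :: "'a set" and adj :: "'a \<Rightarrow> 'a \<Rightarrow> bool"
  assumes finite_V: "finite V"
    and adj_sym: "adj a b \<Longrightarrow> adj b a"
    and adj_V: "adj a b \<Longrightarrow> a \<in> V"
begin

lemma adj_V2: "adj a b \<Longrightarrow> b \<in> V"
  using adj_sym adj_V by blast

lemma successively_adj_rev [simp]: "successively adj (rev p) \<longleftrightarrow> successively adj p"
proof -
  have "(\<lambda>x y. adj y x) = adj" using adj_sym by blast
  then show ?thesis by (simp only: successively_rev)
qed

definition arcs_in :: "'a set \<Rightarrow> 'a rel" where
  "arcs_in X = {(a, b). a \<in> X \<and> b \<in> X \<and> adj a b}"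

definition conn :: "'a set \<Rightarrow> bool" where
  "conn X \<longleftrightarrow> X \<noteq> {} \<and> (\<forall>a \<in> X. \<forall>b \<in> X. (a, b) \<in> (arcs_in X)\<^sup>*)"

lemma arcs_in_mono: "X \<subseteq> Y \<Longrightarrow> (arcs_in X)\<^sup>* \<subseteq> (arcs_in Y)\<^sup>*"
  by (rule rtrancl_mono) (auto simp: arcs_in_def)

lemma arcs_in_rtrancl_sym: "(a, b) \<in> (arcs_in X)\<^sup>* \<Longrightarrow> (b, a) \<in> (arcs_in X)\<^sup>*"
proof -
  have "sym (arcs_in X)" using adj_sym by (auto simp: sym_def arcs_in_def)
  then show "(a, b) \<in> (arcs_in X)\<^sup>* \<Longrightarrow> (b, a) \<in> (arcs_in X)\<^sup>*"
    by (metis symD sym_rtrancl)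
qed

lemma conn_hubI: "c \<in> X \<Longrightarrow> (\<And>a. a \<in> X \<Longrightarrow> (c, a) \<in> (arcs_in X)\<^sup>*) \<Longrightarrow> conn X"
  unfolding conn_def by (meson arcs_in_rtrancl_sym empty_iff rtrancl_trans)

lemma conn_singleton: "conn {a}"
  by (auto simp: conn_def)

lemma conn_list: "p \<noteq> [] \<Longrightarrow> successively adj p \<Longrightarrow> conn (set p)"
proof (induction p)
  case (Cons a p)
  show ?case
  proof (cases "p = []")
    case True then show ?thesis by (simp add: conn_singleton)
  next
    case False
    with Cons have c: "conn (set p)" and e: "adj a (hd p)" by (auto simp: successively_Cons)
    show ?thesis
    proof (rule conn_hubI)
      show "hd p \<in> set (a # p)" using False by simp
      fix b assume "b \<in> set (a # p)"
      then consider "b = a" | "b \<in> set p" by auto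
      then show "(hd p, b) \<in> (arcs_in (set (a # p)))\<^sup>*"
      proof cases
        case 1
        have "(hd p, a) \<in> arcs_in (set (a # p))" using e adj_sym False by (auto simp: arcs_in_def)
        then show ?thesis using 1 by blast
      next
        case 2
        then have "(hd p, b) \<in> (arcs_in (set p))\<^sup>*" using c False by (simp add: conn_def)
        then show ?thesis using arcs_in_mono[of "set p" "set (a # p)"] by auto
      qed
    qed
  qed
qed simp

text \<open>Assembles cores and branch sets. \<open>K\<close> is an old core or, if that is empty,
  the common first vertex of all paths of the label; the \<open>A i\<close> are initial parts of
  these paths. Such a part may be empty, and it may contain the hub itself instead of a neighbour of
  it.\<close>

lemma conn_touching_Union:
  assumes K: "conn K"
    and A: "\<And>i. i \<in> J \<Longrightarrow> A i = {} \<or> conn (A i) \<and> (\<exists>a \<in> A i. \<exists>k \<in> K. a = k \<or> adj k a)"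
  shows "conn (K \<union> (\<Union>i \<in> J. A i))" (is "conn ?U")
proof -
  obtain c where c: "c \<in> K" using K by (auto simp: conn_def)
  have inK: "(c, k) \<in> (arcs_in ?U)\<^sup>*" if "k \<in> K" for k
    using K c that arcs_in_mono[of K ?U] by (auto simp: conn_def)
  show ?thesis
  proof (rule conn_hubI)
    show "c \<in> ?U" using c by blast
    fix b assume "b \<in> ?U"
    then consider "b \<in> K" | i where "i \<in> J" "b \<in> A i" by blast
    then show "(c, b) \<in> (arcs_in ?U)\<^sup>*"
    proof cases
      case 1 then show ?thesis by (rule inK)
    next
      case 2
      then obtain a k where a: "conn (A i)" "a \<in> A i" "k \<in> K" "a = k \<or> adj k a" using A[of i] by blast
      have "(k, a) \<in> (arcs_in ?U)\<^sup>*"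
      proof (cases "a = k")
        case False
        then have "(k, a) \<in> arcs_in ?U" using a 2 by (auto simp: arcs_in_def)
        then show ?thesis by blast
      qed simp
      moreover have "(a, b) \<in> (arcs_in (A i))\<^sup>*" using a 2 by (simp add: conn_def)
      then have "(a, b) \<in> (arcs_in ?U)\<^sup>*" using arcs_in_mono[of "A i" ?U] 2 by blast
      ultimately show ?thesis using inK[OF a(3)] by (meson rtrancl_trans)
    qed
  qed
qed

section \<open>Walks and shortest bridges through a connected set\<close>

lemma rtrancl_arcs_in_list:
  "(a, b) \<in> (arcs_in X)\<^sup>* \<Longrightarrow> a \<in> X \<Longrightarrow>
    \<exists>p. p \<noteq> [] \<and> hd p = a \<and> last p = b \<and> set p \<subseteq> X \<and> successively adj p"
proof (induction rule: rtrancl_induct)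
  case base then show ?case by (intro exI[of _ "[a]"]) auto
next
  case (step b c)
  then obtain p where p: "p \<noteq> []" "hd p = a" "last p = b" "set p \<subseteq> X" "successively adj p" by blast
  then show ?case using step by (intro exI[of _ "p @ [c]"]) (auto simp: arcs_in_def successively_append_iff)
qed

text \<open>A vertex of \<open>C\<close> may be adjacent to \<open>C\<close> too, so \<open>attached\<close> is only used for vertices outside \<open>C\<close>.\<close>

definition attached :: "'a set \<Rightarrow> 'a \<Rightarrow> bool" where
  "attached C u \<longleftrightarrow> (\<exists>c \<in> C. adj u c)"

text \<open>An upper approximation of strong reachability from \<open>w\<close> when
  \<open>C\<close> is the current component: walks replace paths, and inner vertices range over all
  of \<open>C\<close>. \<open>length p < r\<close> allows at most \<open>r\<close> edges. Since
  \<open>w\<close> itself may be missing from the set, \<open>insert w\<close> appears where it has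
  to be counted.\<close>

definition reach :: "nat \<Rightarrow> 'a set \<Rightarrow> 'a \<Rightarrow> 'a set" where
  "reach r C w = {u. \<exists>p. successively adj (w # p @ [u]) \<and> set p \<subseteq> C \<and> length p < r}"

lemma reach_mono: "C \<subseteq> D \<Longrightarrow> reach r C w \<subseteq> reach r D w"
  unfolding reach_def by blast

lemma reach_subset_V: "reach r C w \<subseteq> V"
  unfolding reach_def by (auto simp: successively_append_iff successively_Cons intro: adj_V2)

lemma attached_reach:
  assumes "u \<in> reach r C w" "w \<in> C" shows "attached C u"
proof -
  obtain p where p: "successively adj (w # p @ [u])" "set p \<subseteq> C" using assms by (auto simp: reach_def)
  have "adj (last (w # p)) u" using p(1) by (auto simp: successively_append_iff successively_Cons)
  moreover have "last (w # p) \<in> C" using p(2) assms(2) by (auto simp: last_ConsR)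
  ultimately show ?thesis using adj_sym by (auto simp: attached_def)
qed

text \<open>The middle part is required to be nonempty: the two ends may be adjacent.\<close>

definition bridge :: "'a set \<Rightarrow> 'a \<Rightarrow> 'a \<Rightarrow> 'a list \<Rightarrow> bool" where
  "bridge C a b L \<longleftrightarrow> successively adj L \<and> 3 \<le> length L \<and> hd L = a \<and> last L = b \<and>
    set (butlast (tl L)) \<subseteq> C"

lemma conn_bridge_exists:
  assumes C: "conn C" and a: "attached C a" and b: "attached C b"
  shows "\<exists>L. bridge C a b L"
proof -
  obtain c d where cd: "c \<in> C" "adj a c" "d \<in> C" "adj b d" using a b by (auto simp: attached_def)
  then obtain p where p: "p \<noteq> []" "hd p = c" "last p = d" "set p \<subseteq> C" "successively adj p"
    using C rtrancl_arcs_in_list[of c d C] by (auto simp: conn_def)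
  have "bridge C a b (a # p @ [b])"
    using p cd adj_sym[OF cd(4)] unfolding bridge_def
    by (cases p) (auto simp: successively_append_iff successively_Cons butlast_append hd_append split: if_splits)
  then show ?thesis by blast
qed

lemma bridge_decomp:
  assumes "bridge C a b L"
  shows "\<exists>p. L = a # p @ [b] \<and> p \<noteq> [] \<and> set p \<subseteq> C"
proof -
  have *: "3 \<le> length L" "hd L = a" "last L = b" "set (butlast (tl L)) \<subseteq> C"
    using assms by (auto simp: bridge_def)
  then obtain L' where L': "L = a # L'" by (cases L) auto
  with * have "L' \<noteq> []" "last L' = b" by (auto split: if_splits)
  then have "L' = butlast L' @ [b]" by (metis append_butlast_last_id)
  moreover have "butlast L' \<noteq> []"
  proof
    assume "butlast L' = []"
    then have "length L' = 1" using \<open>L' = butlast L' @ [b]\<close> by (metis append_Nil length_Cons list.size(3) One_nat_def)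
    then show False using * L' by simp
  qed
  ultimately show ?thesis using * L' by (intro exI[of _ "butlast L'"]) auto
qed

text \<open>Replacing the stretch of \<open>L\<close> from \<open>i\<close> to \<open>j\<close> by
  the detour \<open>s\<close> gives another bridge, which cannot be shorter than \<open>L\<close>.
  The assumption \<open>ne\<close> keeps a vertex between the two ends, as \<open>bridge\<close>
  demands.\<close>

lemma bridge_replace:
  assumes L: "bridge C a b L" and min: "\<And>M. bridge C a b M \<Longrightarrow> length L \<le> length M"
    and ij: "i < j" "j < length L"
    and s: "successively adj ([L ! i] @ s @ [L ! j])" "set s \<subseteq> C"
    and ne: "s \<noteq> [] \<or> 0 < i \<or> j < length L - 1"
  shows "j \<le> i + length s + 1"
proof -
  let ?M = "take (Suc i) L @ s @ drop j L"
  obtain p where p: "L = a # p @ [b]" "p \<noteq> []" "set p \<subseteq> C" using bridge_decomp[OF L] by blast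
  have sL: "successively adj L" using L by (simp add: bridge_def)
  have t: "successively adj (take (Suc i) L)" "successively adj (drop j L)"
    using sL by (metis append_take_drop_id successively_append_iff)+
  have lt: "last (take (Suc i) L) = L ! i" using ij by (simp add: take_Suc_conv_app_nth)
  have hdj: "hd (drop j L) = L ! j" using ij by (simp add: hd_drop_conv_nth)
  have tne: "take (Suc i) L \<noteq> []" "drop j L \<noteq> []" using ij by auto
  have 1: "successively adj ?M"
    using s(1) t lt hdj tne
    by (cases "s = []") (auto simp: successively_append_iff successively_Cons)
  have lenM: "length ?M = Suc i + length s + (length L - j)" using ij by simp
  have 2: "3 \<le> length ?M" using ne ij unfolding lenM by (cases s) auto
  have 3: "hd ?M = a" "last ?M = b" using tne p ij by (auto simp: last_drop)
  have tl: "tl ?M = take i (p @ [b]) @ s @ drop j L" using p by simp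
  have bl: "butlast (tl ?M) = take i (p @ [b]) @ s @ butlast (drop j L)"
    unfolding tl using tne(2) by (simp add: butlast_append)
  have i_le: "i \<le> length p" using ij p by simp
  have "set (take i (p @ [b])) \<subseteq> C"
    using p(3) i_le set_take_subset[of i p] by auto
  moreover have "butlast (drop j L) = drop j (butlast L)" by (rule butlast_drop)
  moreover have "butlast L = a # p" using p by (simp add: butlast_append)
  moreover have "set (drop j (a # p)) \<subseteq> C" using ij p(3) set_drop_subset[of "j - 1" p]
    by (cases j) auto
  ultimately have 4: "set (butlast (tl ?M)) \<subseteq> C" using bl s(2) by simp
  have "length L \<le> length ?M" by (rule min) (use 1 2 3 4 in \<open>simp only: bridge_def simp_thms\<close>)
  then show ?thesis using lenM ij by simp
qed

text \<open>The source of the constant: with \<open>k = 2 * r\<close>, positions on a shortest path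
  that are pairwise at most \<open>2 * r\<close> apart number at most
  \<open>2 * r + 1\<close>.\<close>

lemma card_window:
  fixes I :: "nat set"
  assumes "\<And>i j. i \<in> I \<Longrightarrow> j \<in> I \<Longrightarrow> i < j \<Longrightarrow> j \<le> i + k"
  shows "finite I \<and> card I \<le> Suc k"
proof (cases "I = {}")
  case False
  define l where "l = (LEAST i. i \<in> I)"
  have l: "l \<in> I" unfolding l_def using False by (metis LeastI ex_in_conv)
  have "I \<subseteq> {l..l + k}"
  proof
    fix i assume i: "i \<in> I"
    then have "l \<le> i" unfolding l_def by (rule Least_le)
    then show "i \<in> {l..l + k}" using assms[OF l i] by (cases "l = i") auto
  qed
  then show ?thesis using card_mono[of "{l..l + k}" I] finite_subset by fastforce
qed simp

text \<open>The first count is the guarding property for vertices ordered later, with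
  \<open>D\<close> the part of \<open>C\<close> that remains. The second is the price for the
  vertices of \<open>p\<close> when they are ordered; the ends \<open>a\<close> and \<open>b\<close>
  lie outside \<open>C\<close> and are counted there with the earlier vertices.\<close>

lemma geodesic_bridge:
  assumes C: "conn C" and a: "attached C a" "a \<notin> C" and b: "attached C b" "b \<notin> C" and "a \<noteq> b"
  obtains p where "p \<noteq> []" "set p \<subseteq> C" "distinct (a # p @ [b])" "successively adj (a # p @ [b])"
    "\<And>w D. w \<in> D \<Longrightarrow> D \<subseteq> C \<Longrightarrow> card (set (a # p @ [b]) \<inter> reach r D w) \<le> 2 * r + 1"
    "\<And>w. w \<in> set p \<Longrightarrow> card (set p \<inter> insert w (reach r C w)) \<le> 2 * r + 1"
proof -
  obtain L where L: "bridge C a b L" and min: "\<And>M. bridge C a b M \<Longrightarrow> length L \<le> length M"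
    using conn_bridge_exists[OF C a(1) b(1)] ex_has_least_nat[of "bridge C a b" _ length] by blast
  obtain p where p: "L = a # p @ [b]" "p \<noteq> []" "set p \<subseteq> C" using bridge_decomp[OF L] by blast
  have suc: "successively adj L" using L by (simp add: bridge_def)
  \<comment> \<open>Cutting out the closed stretch between two occurrences of \<open>y\<close> would
    give a shorter bridge.\<close>
  have dp: "distinct p"
  proof (rule ccontr)
    assume "\<not> distinct p"
    then obtain xs ys zs y where q: "p = xs @ [y] @ ys @ [y] @ zs" using not_distinct_decomp by blast
    have "bridge C a b (a # (xs @ [y] @ zs) @ [b])"
      using suc p(3) unfolding bridge_def p(1) q
      by (auto simp: successively_append_iff successively_Cons butlast_append hd_append split: if_splits)
    from min[OF this] show False unfolding p(1) q by simp
  qed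
  then have dist: "distinct L" using p a b \<open>a \<noteq> b\<close> by auto
  show thesis
  proof (rule that[OF p(2,3)])
    show "distinct (a # p @ [b])" "successively adj (a # p @ [b])" using dist suc p by auto
  next
    fix w D assume w: "w \<in> D" and D: "D \<subseteq> C"
    define I where "I = {i. i < length L \<and> L ! i \<in> reach r D w}"
    have "finite I \<and> card I \<le> Suc (2 * r)"
    proof (rule card_window)
      fix i j assume i: "i \<in> I" and j: "j \<in> I" and "i < j"
      obtain s where s: "successively adj (w # s @ [L ! i])" "set s \<subseteq> D" "length s < r"
        using i by (auto simp: I_def reach_def)
      obtain t where t: "successively adj (w # t @ [L ! j])" "set t \<subseteq> D" "length t < r"
        using j by (auto simp: I_def reach_def)
      \<comment> \<open>The walks from \<open>w\<close> to the two path vertices, each of at most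
        \<open>r\<close> edges, are glued at \<open>w\<close>. The glued inner part contains
        \<open>w\<close>, so it is nonempty even if both path vertices are the ends.\<close>
      have "successively adj (rev (w # s @ [L ! i]))" using s(1) by (simp only: successively_adj_rev)
      then have st: "successively adj ([L ! i] @ (rev s @ [w] @ t) @ [L ! j])"
        using t(1) by (auto simp: successively_append_iff successively_Cons hd_append split: if_splits)
      have "j \<le> i + length (rev s @ [w] @ t) + 1"
        by (rule bridge_replace[OF L min \<open>i < j\<close> _ st]) (use j s t w D in \<open>auto simp: I_def\<close>)
      then show "j \<le> i + 2 * r" using s(3) t(3) by simp
    qed
    moreover have "set L \<inter> reach r D w \<subseteq> (!) L ` I"
      by (auto simp: I_def in_set_conv_nth)
    ultimately show "card (set (a # p @ [b]) \<inter> reach r D w) \<le> 2 * r + 1"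
      using p(1) by (metis Suc_eq_plus1 card_image_le card_mono finite_imageI le_trans)
  next
    fix w assume "w \<in> set p"
    then obtain k0 where k0: "k0 < length p" "p ! k0 = w" by (auto simp: in_set_conv_nth)
    define k where "k = Suc k0"
    have k: "k < length L - 1" "0 < k" "L ! k = w" using k0 p(1) by (auto simp: k_def nth_append)
    \<comment> \<open>Only inner positions: then an inner vertex of \<open>L\<close> survives every
      replacement, and the detour may be empty, as happens when \<open>w\<close> is adjacent to the
      reached vertex.\<close>
    define I where "I = {i. 0 < i \<and> i < length L - 1 \<and> L ! i \<in> insert w (reach r C w)}"
    have near: "i \<le> k + r \<and> k \<le> i + r" if i: "i \<in> I" for i
    proof (cases "i = k")
      case False
      have "L ! i \<noteq> w"
        using dist k i False by (auto simp: I_def nth_eq_iff_index_eq)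
      then obtain s where s: "successively adj (w # s @ [L ! i])" "set s \<subseteq> C" "length s < r"
        using i by (auto simp: I_def reach_def)
      have s': "successively adj ([L ! i] @ rev s @ [w])"
      proof -
        have "successively adj (rev (w # s @ [L ! i]))" using s(1) by (simp only: successively_adj_rev)
        then show ?thesis by simp
      qed
      show ?thesis
      proof (cases "i < k")
        case True
        have "k \<le> i + length (rev s) + 1"
          by (rule bridge_replace[OF L min True]) (use s s' i k in \<open>auto simp: I_def\<close>)
        then show ?thesis using True s by simp
      next
        case False
        then have ki: "k < i" using \<open>i \<noteq> k\<close> by simp
        have "i \<le> k + length s + 1"
          by (rule bridge_replace[OF L min ki]) (use s i k in \<open>auto simp: I_def\<close>)
        then show ?thesis using ki s by simp
      qed
    qed simp
    have "finite I \<and> card I \<le> Suc (2 * r)"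
    proof (rule card_window)
      fix i j assume "i \<in> I" "j \<in> I"
      from near[OF this(1)] near[OF this(2)] show "j \<le> i + 2 * r" by linarith
    qed
    moreover have "set p \<inter> insert w (reach r C w) \<subseteq> (!) L ` I"
    proof
      fix u assume u: "u \<in> set p \<inter> insert w (reach r C w)"
      then obtain i where i: "i < length p" "p ! i = u" by (auto simp: in_set_conv_nth)
      then have "L ! Suc i = u" "Suc i < length L - 1" using p(1) by (auto simp: nth_append)
      then have "Suc i \<in> I" using u by (simp add: I_def)
      then show "u \<in> (!) L ` I" using \<open>L ! Suc i = u\<close> by blast
    qed
    ultimately show "card (set p \<inter> insert w (reach r C w)) \<le> 2 * r + 1"
      by (metis Suc_eq_plus1 card_image_le card_mono finite_imageI le_trans)
  qed
qed

end

section \<open>Partial models guarded by paths\<close>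

locale guarding = sym_rel V adj
  for V :: "'a set" and adj :: "'a \<Rightarrow> 'a \<Rightarrow> bool" +
  fixes E :: "'c rel" and Iso :: "'c set" and r :: nat
  assumes finite_E: "finite E" and sym_E: "sym E" and irrefl_E: "(x, x) \<notin> E"
    and finite_Iso: "finite Iso" and r_pos: "0 < r" and Iso_E: "Iso \<inter> Field E = {}"
begin

text \<open>
  \<open>C\<close> is the part of the graph not yet ordered, \<open>F\<close> the set of arcs of \<open>H - v\<close> realised so far.
  The edge \<open>xy\<close> is realised by the path \<open>P x y\<close>, which is read from the side of \<open>x\<close> and whose
  two ends are adjacent to the cores \<open>K x\<close> and \<open>K y\<close>. Two paths may meet in their first vertex on
  the side of a common label, and nowhere else. A core may be empty as long as
  all paths of its label start in the same vertex.
\<close>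

definition shape :: "'a set \<Rightarrow> 'c rel \<Rightarrow> ('c \<Rightarrow> 'c \<Rightarrow> 'a list) \<Rightarrow> bool" where
  "shape C F P \<longleftrightarrow> F \<subseteq> E \<and> sym F \<and>
    (\<forall>x y. (x, y) \<in> F \<longrightarrow> P x y \<noteq> [] \<and> distinct (P x y) \<and> successively adj (P x y) \<and>
      set (P x y) \<subseteq> V - C \<and> P y x = rev (P x y))"

definition meets :: "'c rel \<Rightarrow> ('c \<Rightarrow> 'c \<Rightarrow> 'a list) \<Rightarrow> bool" where
  "meets F P \<longleftrightarrow>
    (\<forall>x y a b w. (x, y) \<in> F \<longrightarrow> (a, b) \<in> F \<longrightarrow> w \<in> set (P x y) \<longrightarrow> w \<in> set (P a b) \<longrightarrow>
      {x, y} = {a, b} \<or>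
      (\<exists>l m n. {l, m} = {x, y} \<and> {l, n} = {a, b} \<and> hd (P l m) = w \<and> hd (P l n) = w))"

definition guarded :: "'a set \<Rightarrow> 'c rel \<Rightarrow> ('c \<Rightarrow> 'c \<Rightarrow> 'a list) \<Rightarrow> bool" where
  "guarded C F P \<longleftrightarrow>
    (\<forall>x y w. (x, y) \<in> F \<longrightarrow> w \<in> C \<longrightarrow> card (set (P x y) \<inter> reach r C w) \<le> 2 * r + 1)"

definition paths :: "'a set \<Rightarrow> 'c rel \<Rightarrow> ('c \<Rightarrow> 'c \<Rightarrow> 'a list) \<Rightarrow> bool" where
  "paths C F P \<longleftrightarrow> shape C F P \<and> meets F P \<and> guarded C F P"

definition cores :: "'a set \<Rightarrow> 'c rel \<Rightarrow> ('c \<Rightarrow> 'c \<Rightarrow> 'a list) \<Rightarrow> ('c \<Rightarrow> 'a set) \<Rightarrow> bool" where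
  "cores C F P K \<longleftrightarrow>
    (\<forall>x. K x \<subseteq> V - C \<and> (K x = {} \<or> conn (K x))) \<and>
    (\<forall>x y. x \<noteq> y \<longrightarrow> K x \<inter> K y = {}) \<and>
    (\<forall>x y z. (y, z) \<in> F \<longrightarrow> K x \<inter> set (P y z) = {}) \<and>
    (\<forall>x y z. K x = {} \<longrightarrow> (x, y) \<in> F \<longrightarrow> (x, z) \<in> F \<longrightarrow> hd (P x y) = hd (P x z)) \<and>
    (\<forall>x y. K x \<noteq> {} \<longrightarrow> (x, y) \<in> F \<longrightarrow> (\<exists>k \<in> K x. adj k (hd (P x y))))"

definition isos :: "'a set \<Rightarrow> 'c rel \<Rightarrow> ('c \<Rightarrow> 'c \<Rightarrow> 'a list) \<Rightarrow> ('c \<Rightarrow> 'a set) \<Rightarrow>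
    'c set \<Rightarrow> ('c \<Rightarrow> 'a) \<Rightarrow> bool" where
  "isos C F P K I U \<longleftrightarrow> I \<subseteq> Iso \<and> inj_on U I \<and> U ` I \<subseteq> V - C \<and>
    (\<forall>x. K x \<inter> U ` I = {}) \<and> (\<forall>x y. (x, y) \<in> F \<longrightarrow> set (P x y) \<inter> U ` I = {})"

definition model where
  "model C F P K I U \<longleftrightarrow> paths C F P \<and> cores C F P K \<and> isos C F P K I U"

definition covers where
  "covers C F P I U \<longleftrightarrow> (\<forall>u \<in> V - C. attached C u \<longrightarrow>
    u \<in> U ` I \<or> (\<exists>x y. (x, y) \<in> F \<and> u \<in> set (P x y)))"

text \<open>Satisfied by every inclusion-minimal \<open>F\<close> whose paths still cover the attached vertices.\<close>

definition has_private where
  "has_private C F P \<longleftrightarrow> (\<forall>x y. (x, y) \<in> F \<longrightarrow> (\<exists>u \<in> set (P x y). attached C u \<and>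
    (\<forall>a b. (a, b) \<in> F \<longrightarrow> u \<in> set (P a b) \<longrightarrow> {a, b} = {x, y})))"

text \<open>An isolated vertex of H - v becomes a branch set with one vertex, so this vertex itself
  must be attached to \<open>C\<close>.\<close>

definition state where
  "state C F P K I U \<longleftrightarrow> conn C \<and> C \<subseteq> V \<and> model C F P K I U \<and> covers C F P I U \<and>
    has_private C F P \<and> (\<forall>i \<in> I. attached C (U i))"

section \<open>Access to the invariants and basic changes of a model\<close>

lemma coresD:
  assumes "cores C F P K"
  shows "K x \<subseteq> V" "K x \<inter> C = {}" "K x \<noteq> {} \<Longrightarrow> conn (K x)" "x \<noteq> y \<Longrightarrow> K x \<inter> K y = {}"
    "(y, z) \<in> F \<Longrightarrow> K x \<inter> set (P y z) = {}"
    "K x = {} \<Longrightarrow> (x, y) \<in> F \<Longrightarrow> (x, z) \<in> F \<Longrightarrow> hd (P x y) = hd (P x z)"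
    "K x \<noteq> {} \<Longrightarrow> (x, y) \<in> F \<Longrightarrow> \<exists>k \<in> K x. adj k (hd (P x y))"
proof -
  note c = assms[unfolded cores_def]
  show "K x \<subseteq> V" "K x \<inter> C = {}" "K x \<noteq> {} \<Longrightarrow> conn (K x)" using c by blast+
  note c' = c[THEN conjunct2]
  show "x \<noteq> y \<Longrightarrow> K x \<inter> K y = {}" by (rule c'[THEN conjunct1, rule_format])
  note c'' = c'[THEN conjunct2]
  show "(y, z) \<in> F \<Longrightarrow> K x \<inter> set (P y z) = {}" by (rule c''[THEN conjunct1, rule_format])
  note c3 = c''[THEN conjunct2]
  show "K x = {} \<Longrightarrow> (x, y) \<in> F \<Longrightarrow> (x, z) \<in> F \<Longrightarrow> hd (P x y) = hd (P x z)"
    by (rule c3[THEN conjunct1, rule_format])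
  show "K x \<noteq> {} \<Longrightarrow> (x, y) \<in> F \<Longrightarrow> \<exists>k \<in> K x. adj k (hd (P x y))"
    by (rule c3[THEN conjunct2, rule_format])
qed

lemma coresI:
  assumes "\<And>x. K x \<subseteq> V" "\<And>x. K x \<inter> C = {}" "\<And>x. K x \<noteq> {} \<Longrightarrow> conn (K x)"
    and "\<And>x y. x \<noteq> y \<Longrightarrow> K x \<inter> K y = {}"
    and "\<And>x y z. (y, z) \<in> F \<Longrightarrow> K x \<inter> set (P y z) = {}"
    and "\<And>x y z. K x = {} \<Longrightarrow> (x, y) \<in> F \<Longrightarrow> (x, z) \<in> F \<Longrightarrow> hd (P x y) = hd (P x z)"
    and "\<And>x y. K x \<noteq> {} \<Longrightarrow> (x, y) \<in> F \<Longrightarrow> \<exists>k \<in> K x. adj k (hd (P x y))"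
  shows "cores C F P K"
  unfolding cores_def
proof (intro conjI allI impI)
  show "K x \<subseteq> V - C" for x using assms(1,2)[of x] by blast
  show "K x = {} \<or> conn (K x)" for x using assms(3) by blast
qed (fact assms)+

lemma isosD:
  assumes "isos C F P K I U"
  shows "I \<subseteq> Iso" "inj_on U I" "U ` I \<subseteq> V" "U ` I \<inter> C = {}" "K x \<inter> U ` I = {}"
    "(x, y) \<in> F \<Longrightarrow> set (P x y) \<inter> U ` I = {}"
proof -
  note c = assms[unfolded isos_def]
  show "I \<subseteq> Iso" "inj_on U I" "K x \<inter> U ` I = {}" "(x, y) \<in> F \<Longrightarrow> set (P x y) \<inter> U ` I = {}"
    using c by simp_all
  show "U ` I \<subseteq> V" "U ` I \<inter> C = {}" using c by blast+
qed

lemma isosI: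
  assumes "I \<subseteq> Iso" "inj_on U I" "U ` I \<subseteq> V" "U ` I \<inter> C = {}" "\<And>x. K x \<inter> U ` I = {}"
    "\<And>x y. (x, y) \<in> F \<Longrightarrow> set (P x y) \<inter> U ` I = {}"
  shows "isos C F P K I U"
  unfolding isos_def
proof (intro conjI allI impI)
  show "U ` I \<subseteq> V - C" using assms(3,4) by blast
qed (fact assms)+

lemma shapeD:
  assumes "shape C F P" "(x, y) \<in> F"
  shows "(y, x) \<in> F" "(x, y) \<in> E" "P x y \<noteq> []" "distinct (P x y)" "successively adj (P x y)"
    "set (P x y) \<subseteq> V" "set (P x y) \<inter> C = {}" "P y x = rev (P x y)"
  using assms unfolding shape_def sym_def by blast+

lemma paths_shape: "paths C F P \<Longrightarrow> shape C F P"
  by (simp add: paths_def)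

lemmas pathsD = shapeD[OF paths_shape]

lemma pathsD_sub: "paths C F P \<Longrightarrow> F \<subseteq> E" "paths C F P \<Longrightarrow> sym F"
  by (simp_all add: paths_def shape_def)

lemma paths_meet:
  assumes "paths C F P" "(x, y) \<in> F" "(a, b) \<in> F" "w \<in> set (P x y)" "w \<in> set (P a b)"
  shows "{x, y} = {a, b} \<or>
      (\<exists>l m n. {l, m} = {x, y} \<and> {l, n} = {a, b} \<and> hd (P l m) = w \<and> hd (P l n) = w)"
proof -
  have "meets F P" using assms(1) by (simp add: paths_def)
  then show ?thesis using assms(2-) unfolding meets_def by simp
qed

lemma paths_card:
  assumes "paths C F P" "(x, y) \<in> F" "w \<in> C"
  shows "card (set (P x y) \<inter> reach r C w) \<le> 2 * r + 1"
  using assms by (simp add: paths_def guarded_def)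

text \<open>\<open>C\<close> enters a model only through sets that must avoid it and through upper
  bounds on \<open>reach\<close>, which is monotone in \<open>C\<close>.\<close>

lemma model_shrink:
  assumes "model C F P K I U" "D \<subseteq> C"
  shows "model D F P K I U"
proof -
  have p: "paths C F P" and c: "cores C F P K" and i: "isos C F P K I U" using assms(1) by (auto simp: model_def)
  have "shape D F P" using paths_shape[OF p] assms(2) unfolding shape_def by blast
  moreover have "guarded D F P"
    unfolding guarded_def
  proof (intro allI impI)
    fix x y w assume xy: "(x, y) \<in> F" and "w \<in> D"
    then have "card (set (P x y) \<inter> reach r C w) \<le> 2 * r + 1" using paths_card[OF p xy] assms(2) by blast
    moreover have "card (set (P x y) \<inter> reach r D w) \<le> card (set (P x y) \<inter> reach r C w)"
      by (rule card_mono) (use reach_mono[OF assms(2)] in auto)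
    ultimately show "card (set (P x y) \<inter> reach r D w) \<le> 2 * r + 1" by simp
  qed
  ultimately have "paths D F P" using p by (simp add: paths_def)
  moreover have "cores D F P K" using c assms(2) unfolding cores_def by blast
  moreover have "isos D F P K I U" using i assms(2) unfolding isos_def by blast
  ultimately show ?thesis by (simp add: model_def)
qed

lemma model_restrict:
  assumes "model C F P K I U" "F' \<subseteq> F" "sym F'" "I' \<subseteq> I"
  shows "model C F' P K I' U"
proof -
  have p: "paths C F P" and c: "cores C F P K" and i: "isos C F P K I U" using assms(1) by (auto simp: model_def)
  have "shape C F' P" using paths_shape[OF p] assms(2,3) unfolding shape_def by blast
  moreover have "meets F' P" unfolding meets_def
    using paths_meet[OF p] assms(2) by (meson subsetD)
  moreover have "guarded C F' P" unfolding guarded_def using paths_card[OF p] assms(2) by blast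
  ultimately have "paths C F' P" by (simp add: paths_def)
  moreover have "cores C F' P K"
  proof (rule coresI)
    show "K x \<inter> set (P y z) = {}" if "(y, z) \<in> F'" for x y z using coresD(5)[OF c] that assms(2) by blast
    show "hd (P x y) = hd (P x z)" if "K x = {}" "(x, y) \<in> F'" "(x, z) \<in> F'" for x y z
      by (rule coresD(6)[OF c that(1)]) (use that assms(2) in blast)+
    show "\<exists>k \<in> K x. adj k (hd (P x y))" if "K x \<noteq> {}" "(x, y) \<in> F'" for x y
      by (rule coresD(7)[OF c that(1)]) (use that assms(2) in blast)
  qed (use coresD(1-4)[OF c] in blast)+
  moreover have UI: "U ` I' \<subseteq> U ` I" using assms(4) by blast
  have "isos C F' P K I' U"
  proof (rule isosI)
    show "I' \<subseteq> Iso" using isosD(1)[OF i] assms(4) by blast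
    show "inj_on U I'" using isosD(2)[OF i] assms(4) by (rule inj_on_subset)
    show "U ` I' \<subseteq> V" using UI isosD(3)[OF i] by (rule order_trans)
    show "U ` I' \<inter> C = {}" using UI isosD(4)[OF i] by blast
    show "K x \<inter> U ` I' = {}" for x using UI isosD(5)[OF i, of x] by blast
    show "set (P x y) \<inter> U ` I' = {}" if "(x, y) \<in> F'" for x y
      using UI isosD(6)[OF i subsetD[OF assms(2) that]] by blast
  qed
  ultimately show ?thesis by (simp add: model_def)
qed

text \<open>This is where edges are forgotten. If a path had no private attached vertex, its edge
  could be dropped without uncovering anything, so a covering \<open>F'\<close> of least size has
  private vertices on all paths. Isolated labels whose vertex is no longer attached are dropped as
  well.\<close>

lemma state_of_covers:
  assumes "conn C" "C \<subseteq> V" and model: "model C F P K I U" and cov: "covers C F P I U"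
  shows "\<exists>F' I'. state C F' P K I' U"
proof -
  define good where "good F' \<longleftrightarrow> F' \<subseteq> F \<and> sym F' \<and> covers C F' P I U" for F'
  have F: "F \<subseteq> E" "sym F" using model by (auto simp: model_def dest: pathsD_sub)
  have "good F" using cov F by (simp add: good_def)
  then obtain F' where F': "good F'" and min: "\<And>F''. good F'' \<Longrightarrow> card F' \<le> card F''"
    using ex_has_least_nat[of good F card] by blast
  have fin: "finite F'" using F' F(1) finite_E unfolding good_def by (meson finite_subset)
  have "has_private C F' P"
    unfolding has_private_def
  proof (intro allI impI, rule ccontr)
    fix x y assume xy: "(x, y) \<in> F'"
      and no: "\<not> (\<exists>u \<in> set (P x y). attached C u \<and>
        (\<forall>a b. (a, b) \<in> F' \<longrightarrow> u \<in> set (P a b) \<longrightarrow> {a, b} = {x, y}))"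
    let ?F = "F' - {(x, y), (y, x)}"
    have "covers C ?F P I U"
      unfolding covers_def
    proof (intro ballI impI)
      fix u assume u: "u \<in> V - C" "attached C u"
      show "u \<in> U ` I \<or> (\<exists>x y. (x, y) \<in> ?F \<and> u \<in> set (P x y))"
      proof (cases "u \<in> U ` I")
        case False
        then obtain a b where ab: "(a, b) \<in> F'" "u \<in> set (P a b)"
          using F' u unfolding good_def covers_def by blast
        show ?thesis
        proof (cases "{a, b} = {x, y}")
          case True
          have "(x, y) \<in> F" using xy F' by (auto simp: good_def)
          with model have "P y x = rev (P x y)" by (auto simp: model_def dest: pathsD(8))
          then have "u \<in> set (P x y)" using ab True by (auto simp: doubleton_eq_iff)
          then obtain c d where "(c, d) \<in> F'" "u \<in> set (P c d)" "{c, d} \<noteq> {x, y}" using no u by blast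
          then show ?thesis by blast
        next
          case False
          then show ?thesis using ab by blast
        qed
      qed simp
    qed
    moreover have "sym ?F" using F' unfolding good_def sym_def by blast
    ultimately have "good ?F" using F' by (auto simp: good_def)
    then have "card F' \<le> card ?F" by (rule min)
    moreover have "card ?F < card F'" using fin xy by (intro psubset_card_mono) auto
    ultimately show False by simp
  qed
  moreover have "covers C F' P {i \<in> I. attached C (U i)} U"
    using F' unfolding good_def covers_def by blast
  moreover have "model C F' P K {i \<in> I. attached C (U i)} U"
    by (rule model_restrict[OF model]) (use F' in \<open>auto simp: good_def\<close>)
  ultimately show ?thesis using assms(1,2) unfolding state_def by blast
qed

text \<open>Common to all ways of realising an edge. \<open>L\<close> may start and end in old
  vertices outside \<open>C\<close>, but there it may meet old paths only in first vertices at
  \<open>y\<close> or \<open>z\<close>; \<open>D\<close> is the region left after the rest of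
  \<open>L\<close> is removed from \<open>C\<close>.\<close>

lemma model_add_edge:
  assumes model: "model C F P K I U" and yz: "(y, z) \<in> E"
    and CD: "D \<subseteq> C"
    and L: "L \<noteq> []" "distinct L" "successively adj L" "set L \<subseteq> V - D"
    and new: "(y, z) \<notin> F"
    and meet: "\<And>a b w. (a, b) \<in> F \<Longrightarrow> w \<in> set L \<Longrightarrow> w \<in> set (P a b) \<Longrightarrow>
      w = hd L \<and> (\<exists>n. {a, b} = {y, n} \<and> hd (P y n) = w) \<or>
      w = last L \<and> (\<exists>n. {a, b} = {z, n} \<and> hd (P z n) = w)"
    and KL: "\<And>x. K x \<inter> set L = {}" and UL: "U ` I \<inter> set L = {}"
    and Ky: "K y = {} \<Longrightarrow> (\<And>n. (y, n) \<in> F \<Longrightarrow> hd (P y n) = hd L)"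
      "K y \<noteq> {} \<Longrightarrow> \<exists>k \<in> K y. adj k (hd L)"
    and Kz: "K z = {} \<Longrightarrow> (\<And>n. (z, n) \<in> F \<Longrightarrow> hd (P z n) = last L)"
      "K z \<noteq> {} \<Longrightarrow> \<exists>k \<in> K z. adj k (last L)"
    and card: "\<And>w. w \<in> D \<Longrightarrow> card (set L \<inter> reach r D w) \<le> 2 * r + 1"
  shows "model D (F \<union> {(y, z), (z, y)})
    (\<lambda>a b. if a = y \<and> b = z then L else if a = z \<and> b = y then rev L else P a b) K I U"
    (is "model D ?F ?P K I U")
proof -
  define Q where "Q = ?P"
  have mD: "model D F P K I U" by (rule model_shrink[OF model CD])
  then have p: "paths D F P" and c: "cores D F P K" and i: "isos D F P K I U" by (auto simp: model_def)
  have neq: "y \<noteq> z" using yz irrefl_E by blast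
  have F: "F \<subseteq> E" "sym F" using pathsD_sub[OF p] by auto
  have zyF: "(z, y) \<notin> F" using new F(2) by (meson symD)
  have old: "Q a b = P a b" if "(a, b) \<in> F" for a b
  proof -
    have "\<not> (a = y \<and> b = z)" "\<not> (a = z \<and> b = y)" using that new zyF by blast+
    then show ?thesis by (simp only: Q_def if_False)
  qed
  have Pyz: "Q y z = L" "Q z y = rev L" using neq by (auto simp: Q_def)
  have meet': "{a, b} = {y, z} \<or>
      (\<exists>l m n. {l, m} = {y, z} \<and> {l, n} = {a, b} \<and> hd (Q l m) = w \<and> hd (Q l n) = w)"
    if ab: "(a, b) \<in> F" "w \<in> set L" "w \<in> set (P a b)" for a b w
  proof -
    consider n where "w = hd L" "{a, b} = {y, n}" "hd (P y n) = w"
      | n where "w = last L" "{a, b} = {z, n}" "hd (P z n) = w"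
      using meet[OF ab] by blast
    then show ?thesis
    proof cases
      case 1
      then have "(y, n) \<in> F" using ab(1) F(2) by (metis doubleton_eq_iff symD)
      then have "hd (Q y n) = w" using 1 old[of y n] by (simp only:)
      moreover have "hd (Q y z) = w" using 1 Pyz by simp
      ultimately show ?thesis using 1(2) by blast
    next
      case 2
      then have "(z, n) \<in> F" using ab(1) F(2) by (metis doubleton_eq_iff symD)
      then have "hd (Q z n) = w" using 2 old[of z n] by (simp only:)
      moreover have "hd (Q z y) = w" using 2 Pyz L(1) by (simp only: hd_rev)
      ultimately have "{z, y} = {y, z} \<and> {z, n} = {a, b} \<and> hd (Q z y) = w \<and> hd (Q z n) = w"
        using 2(2) by (intro conjI) (simp_all only: insert_commute)
      then show ?thesis by (intro disjI2 exI)
    qed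
  qed
  have cases: "(a, b) \<in> F \<or> {a, b} = {y, z}" if "(a, b) \<in> ?F" for a b using that by auto
  have setP: "set (Q a b) = set L" if "{a, b} = {y, z}" for a b
    using that Pyz by (metis doubleton_eq_iff set_rev)
  have "shape D ?F Q"
    unfolding shape_def
  proof (intro conjI allI impI)
    show "?F \<subseteq> E" using F(1) yz symD[OF sym_E yz] by blast
    show "sym ?F" using F(2) unfolding sym_def by blast
  next
    fix a b assume ab: "(a, b) \<in> ?F"
    have "Q a b \<noteq> [] \<and> distinct (Q a b) \<and> successively adj (Q a b) \<and> set (Q a b) \<subseteq> V - D \<and> Q b a = rev (Q a b)"
    proof (cases "(a, b) \<in> F")
      case True
      have "set (P a b) \<subseteq> V - D" using pathsD(6,7)[OF p True] by blast
      then show ?thesis using pathsD(3-5,8)[OF p True] old[OF True] old[OF pathsD(1)[OF p True]] by simp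
    next
      case False
      then consider "a = y" "b = z" | "a = z" "b = y" using ab by blast
      then show ?thesis
        by cases (use L Pyz successively_adj_rev in \<open>simp_all del: successively_rev\<close>)
    qed
    then show "Q a b \<noteq> []" "distinct (Q a b)" "successively adj (Q a b)" "set (Q a b) \<subseteq> V - D" "Q b a = rev (Q a b)"
      by blast+
  qed
  moreover have "meets ?F Q"
    unfolding meets_def
  proof (intro allI impI)
    fix a b a' b' w
    assume ab: "(a, b) \<in> ?F" and ab': "(a', b') \<in> ?F" and w: "w \<in> set (Q a b)" "w \<in> set (Q a' b')"
    show "{a, b} = {a', b'} \<or> (\<exists>l m n. {l, m} = {a, b} \<and> {l, n} = {a', b'} \<and> hd (Q l m) = w \<and> hd (Q l n) = w)"
    proof (cases "(a, b) \<in> F")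
      case abF: True
      show ?thesis
      proof (cases "(a', b') \<in> F")
        case True
        have symF: "(c, d) \<in> F" if "{c, d} = {e, f}" "(e, f) \<in> F" for c d e f
          using that F(2) by (metis doubleton_eq_iff symD)
        from paths_meet[OF p abF True] w old[OF abF] old[OF True]
        consider "{a, b} = {a', b'}" | l m n where "{l, m} = {a, b}" "{l, n} = {a', b'}" "hd (P l m) = w" "hd (P l n) = w"
          by metis
        then show ?thesis
        proof cases
          case 2
          have "hd (Q l m) = w" "hd (Q l n) = w"
            using 2 old[OF symF[OF 2(1) abF]] old[OF symF[OF 2(2) True]] by (simp_all only:)
          with 2(1,2) show ?thesis by blast
        qed simp
      next
        case False
        then have e: "{a', b'} = {y, z}" using cases[OF ab'] by simp
        have "w \<in> set L" "w \<in> set (P a b)" using w setP[OF e] old[OF abF] by auto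
        from meet'[OF abF this] show ?thesis unfolding e
          by (elim disjE exE conjE) (simp, intro disjI2 exI conjI)
      qed
    next
      case False
      then have e: "{a, b} = {y, z}" using cases[OF ab] by simp
      show ?thesis
      proof (cases "(a', b') \<in> F")
        case True
        have "w \<in> set L" "w \<in> set (P a' b')" using w setP[OF e] old[OF True] by auto
        from meet'[OF True this] show ?thesis unfolding e
          by (elim disjE exE conjE) (simp, intro disjI2 exI conjI)
      next
        case False
        then show ?thesis using cases[OF ab'] e by simp
      qed
    qed
  qed
  moreover have "guarded D ?F Q"
    unfolding guarded_def
  proof (intro allI impI)
    fix a b w assume ab: "(a, b) \<in> ?F" and "w \<in> D"
    then show "card (set (Q a b) \<inter> reach r D w) \<le> 2 * r + 1"
      using cases[OF ab] old[of a b] paths_card[OF p, of a b w] setP[of a b] card[of w] by metis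
  qed
  ultimately have "paths D ?F Q" by (simp add: paths_def)
  moreover have "cores D ?F Q K"
  proof (rule coresI)
    fix x
    show "K x \<subseteq> V" "K x \<inter> D = {}" "K x \<noteq> {} \<Longrightarrow> conn (K x)" "x \<noteq> x' \<Longrightarrow> K x \<inter> K x' = {}" for x'
      by (fact coresD[OF c])+
    show "K x \<inter> set (Q a b) = {}" if ab: "(a, b) \<in> ?F" for a b
      using cases[OF ab] coresD(5)[OF c, of a b x] old[of a b] setP[of a b] KL[of x] by auto
    show "hd (Q x b) = hd (Q x b')" if e: "K x = {}" "(x, b) \<in> ?F" "(x, b') \<in> ?F" for b b'
    proof -
      consider "x = y" | "x = z" | "x \<noteq> y" "x \<noteq> z" by blast
      then show ?thesis
      proof cases
        case 1
        then have "hd (Q y n) = hd L" if "(y, n) \<in> ?F" for n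
          using Ky(1)[of n] that e(1) 1 neq old[of y n] Pyz by auto
        then show ?thesis using e 1 by metis
      next
        case 2
        then have "hd (Q z n) = last L" if "(z, n) \<in> ?F" for n
          using Kz(1)[of n] that e(1) 2 neq old[of z n] L(1) Pyz by (auto simp: hd_rev)
        then show ?thesis using e 2 by metis
      next
        case 3
        then show ?thesis using coresD(6)[OF c e(1), of b b'] e old[of x b] old[of x b'] by auto
      qed
    qed
    show "\<exists>k \<in> K x. adj k (hd (Q x b))" if ne: "K x \<noteq> {}" and b: "(x, b) \<in> ?F" for b
    proof -
      consider "x = y" "b = z" | "x = z" "b = y" | "(x, b) \<in> F" using cases[OF b] by (auto simp: doubleton_eq_iff)
      then show ?thesis
      proof cases
        case 1 then show ?thesis using Ky(2) ne Pyz by simp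
      next
        case 2 then show ?thesis using Kz(2) ne Pyz L(1) by (simp add: hd_rev)
      next
        case 3 then show ?thesis using coresD(7)[OF c ne 3] old[OF 3] by simp
      qed
    qed
  qed
  moreover have "isos D ?F Q K I U"
  proof (rule isosI)
    show "set (Q a b) \<inter> U ` I = {}" if ab: "(a, b) \<in> ?F" for a b
      using cases[OF ab] isosD(6)[OF i, of a b] old[of a b] setP[of a b] UL by (metis Int_commute)
  qed (fact isosD[OF i])+
  ultimately show ?thesis by (simp only: model_def flip: Q_def)
qed

text \<open>A core can outlive the paths of its label once edges are forgotten. It must be emptied
  before the label is used again, because a new path would have to start next to it.\<close>

lemma model_reset_core:
  assumes "model C F P K I U" "\<And>n. (z, n) \<notin> F"
  shows "model C F P (K(z := {})) I U"
proof -
  have p: "paths C F P" and c: "cores C F P K" and i: "isos C F P K I U" using assms(1) by (auto simp: model_def)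
  have "cores C F P (K(z := {}))"
  proof (rule coresI)
    show "hd (P x a) = hd (P x b)" if "(K(z := {})) x = {}" "(x, a) \<in> F" "(x, b) \<in> F" for x a b
      by (rule coresD(6)[OF c]) (use that assms(2) in \<open>auto split: if_splits\<close>)
    show "\<exists>k \<in> (K(z := {})) x. adj k (hd (P x y))" if "(K(z := {})) x \<noteq> {}" "(x, y) \<in> F" for x y
      using coresD(7)[OF c, of x y] that by (simp split: if_splits)
  qed (use coresD(1-5)[OF c] in \<open>auto split: if_splits\<close>)
  moreover have "isos C F P (K(z := {})) I U"
    by (rule isosI) (use isosD[OF i] in auto)
  ultimately show ?thesis using p by (simp add: model_def)
qed

lemma model_add_iso:
  assumes "model C F P K I U" "i \<in> Iso" "i \<notin> I" "u \<in> C" "C \<subseteq> V"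
  shows "model (C - {u}) F P K (insert i I) (U(i := u))"
proof -
  have p: "paths C F P" and c: "cores C F P K" and i: "isos C F P K I U" using assms by (auto simp: model_def)
  have im: "U(i := u) ` insert i I = insert u (U ` I)" using assms(3) by auto
  have "isos (C - {u}) F P K (insert i I) (U(i := u))"
  proof (rule isosI)
    show "inj_on (U(i := u)) (insert i I)"
      using isosD(2,4)[OF i] assms(3,4) by (auto simp: inj_on_def)
    show "insert i I \<subseteq> Iso" using isosD(1)[OF i] assms(2) by blast
    show "set (P x y) \<inter> U(i := u) ` insert i I = {}" if "(x, y) \<in> F" for x y
      unfolding im using pathsD(7)[OF p that] isosD(6)[OF i that] assms(4) by blast
    show "K x \<inter> U(i := u) ` insert i I = {}" for x
      unfolding im using coresD(2)[OF c, of x] isosD(5)[OF i, of x] assms(4) by blast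
    show "U(i := u) ` insert i I \<subseteq> V" "U(i := u) ` insert i I \<inter> (C - {u}) = {}"
      unfolding im using isosD(3,4)[OF i] assms(4,5) by blast+
  qed
  then show ?thesis using model_shrink[OF assms(1), of "C - {u}"] by (auto simp: model_def)
qed

section \<open>Trimming the paths\<close>

lemma stateD:
  assumes "state C F P K I U"
  shows "conn C" "C \<subseteq> V" "model C F P K I U" "paths C F P" "cores C F P K" "isos C F P K I U"
    "covers C F P I U" "has_private C F P" "i \<in> I \<Longrightarrow> attached C (U i)"
  using assms by (simp_all add: state_def model_def)

lemma has_privateD:
  assumes "has_private C F P" "(x, y) \<in> F"
  obtains u where "u \<in> set (P x y)" "attached C u"
    "\<forall>a b. (a, b) \<in> F \<longrightarrow> u \<in> set (P a b) \<longrightarrow> {a, b} = {x, y}"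
  using assms unfolding has_private_def by blast

lemma set_paths_eq:
  assumes "paths C F P" "(x, y) \<in> F" "{a, b} = {x, y}"
  shows "set (P a b) = set (P x y)" "(a, b) \<in> F"
proof -
  consider "a = x" "b = y" | "a = y" "b = x" using assms(3) by (auto simp: doubleton_eq_iff)
  then show "set (P a b) = set (P x y)" "(a, b) \<in> F"
    by (cases; use pathsD(1,8)[OF assms(1,2)] assms(2) in simp)+
qed

text \<open>Makes all first vertices at \<open>y\<close> attached, so that a new path can start
  there: the unattached beginning of every path at \<open>y\<close> is moved into the core of
  \<open>y\<close>. Something remains of each path because it has an attached vertex, and since only
  unattached vertices move, covering and private vertices are preserved.\<close>

lemma state_trim:
  assumes st: "state C F P K I U"
  obtains P' K' where "state C F P' K' I U" "\<And>n. (y, n) \<in> F \<Longrightarrow> attached C (hd (P' y n))"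
    "\<And>z n. z \<noteq> y \<Longrightarrow> (z, n) \<in> F \<Longrightarrow> hd (P' z n) = hd (P z n)"
    "\<And>a b. (a, b) \<in> F \<Longrightarrow> {u \<in> set (P' a b). attached C u} = {u \<in> set (P a b). attached C u}"
proof -
  note p = stateD(4)[OF st] and c = stateD(5)[OF st] and i = stateD(6)[OF st]
  define un where "un u \<longleftrightarrow> \<not> attached C u" for u
  define D where "D n = dropWhile un (P y n)" for n
  define T where "T n = takeWhile un (P y n)" for n
  define Q where "Q a b = (if a = y then D b else if b = y then rev (D a) else P a b)" for a b
  define N where "N = {n. (y, n) \<in> F}"
  define K' where "K' = K(y := K y \<union> (\<Union>n \<in> N. set (T n)))"
  have F: "F \<subseteq> E" "sym F" using pathsD_sub[OF p] by auto
  have irF: "(x, x) \<notin> F" for x using F irrefl_E by blast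
  have TD: "P y n = T n @ D n" for n by (simp add: T_def D_def)
  have Tun: "un u" if "u \<in> set (T n)" for u n using that by (auto simp: T_def dest: set_takeWhileD)
  have Dne: "D n \<noteq> []" if n: "(y, n) \<in> F" for n
  proof -
    obtain u where "u \<in> set (P y n)" "attached C u" using has_privateD[OF stateD(8)[OF st] n] .
    then show ?thesis by (auto simp: D_def un_def)
  qed
  have Dhd: "\<not> un (hd (D n))" if "(y, n) \<in> F" for n
    using Dne[OF that] unfolding D_def by (rule hd_dropWhile)
  have TDdist: "set (T n) \<inter> set (D n) = {}" if "(y, n) \<in> F" for n
    using pathsD(4)[OF p that] by (simp add: TD)
  have T_hd: "hd (T n) = hd (P y n)" if "T n \<noteq> []" for n using that by (simp add: TD)
  have D_eq: "T n = []" "D n = P y n" if "(y, n) \<in> F" "\<not> un (hd (P y n))" for n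
    using that pathsD(3)[OF p that(1)] unfolding T_def D_def by (cases "P y n"; simp)+
  have hdT: "un (hd (P y n))" if "T n \<noteq> []" for n
    using Tun[OF hd_in_set[OF that]] T_hd[OF that] by simp
  have Qy: "Q y n = D n" for n by (simp add: Q_def)
  have Qrev: "Q b a = rev (Q a b)" if ab: "(a, b) \<in> F" for a b
    using irF[of y] ab pathsD(8)[OF p ab] by (auto simp: Q_def)
  have setQ: "set (Q a b) = set (D n)" if "(a, b) \<in> F" "{a, b} = {y, n}" for a b n
    using that irF[of y] by (auto simp: Q_def doubleton_eq_iff)
  have Qsub: "set (Q a b) \<subseteq> set (P a b)" if ab: "(a, b) \<in> F" for a b
  proof -
    consider "a = y" | "b = y" "a \<noteq> y" | "a \<noteq> y" "b \<noteq> y" by blast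
    then show ?thesis
    proof cases
      case 1 then show ?thesis by (auto simp: Qy TD)
    next
      case 2
      then have "P a y = rev (P y a)" using ab pathsD(1)[OF p ab] pathsD(8)[OF p, of y a] by simp
      then show ?thesis using 2 by (auto simp: Q_def TD)
    next
      case 3 then show ?thesis by (simp add: Q_def)
    qed
  qed
  have Qatt: "{u \<in> set (Q a b). attached C u} = {u \<in> set (P a b). attached C u}" if ab: "(a, b) \<in> F" for a b
  proof -
    have D: "{u \<in> set (D n). attached C u} = {u \<in> set (P y n). attached C u}" for n
      using Tun[of _ n] by (auto simp: TD un_def)
    consider "a = y" | "b = y" "a \<noteq> y" | "a \<noteq> y" "b \<noteq> y" by blast
    then show ?thesis
    proof cases
      case 1 then show ?thesis by (simp add: Qy D)
    next
      case 2
      then have "P a y = rev (P y a)" using ab pathsD(1)[OF p ab] pathsD(8)[OF p, of y a] by simp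
      then show ?thesis using 2 D[of a] by (simp add: Q_def)
    next
      case 3 then show ?thesis by (simp add: Q_def)
    qed
  qed
  have last_D: "last (D n) = last (P y n)" if "(y, n) \<in> F" for n using Dne[OF that] by (simp add: TD)
  have hdQ: "hd (Q z n) = hd (P z n)" if "z \<noteq> y" "(z, n) \<in> F" for z n
  proof (cases "n = y")
    case True
    have yz: "(y, z) \<in> F" using pathsD(1)[OF p that(2)] True by simp
    have "hd (Q z y) = last (D z)" using that(1) Dne[OF yz] by (simp add: Q_def hd_rev)
    also have "\<dots> = hd (P z y)" using last_D[OF yz] pathsD(8)[OF p yz] pathsD(3)[OF p yz] by (simp add: hd_rev)
    finally show ?thesis using True by simp
  next
    case False then show ?thesis using that(1) by (simp add: Q_def)
  qed
  \<comment> \<open>A shared first vertex that survives trimming is still first: at \<open>y\<close>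
    its survival means that nothing was cut off.\<close>
  have hdQ': "hd (Q l m) = w" if lm: "(l, m) \<in> F" and w: "hd (P l m) = w" "w \<in> set (Q l m)" for l m w
  proof (cases "l = y")
    case True
    then have n: "(y, m) \<in> F" and wD: "w \<in> set (D m)" using lm w by (auto simp: Qy)
    have "T m = []"
    proof (rule ccontr)
      assume ne: "T m \<noteq> []"
      then have "w \<in> set (T m)" using T_hd[OF ne] w True by (metis hd_in_set)
      then show False using TDdist[OF n] wD by blast
    qed
    then show ?thesis using True w TD[of m] by (simp add: Qy)
  next
    case False then show ?thesis using hdQ[OF False lm] w by simp
  qed
  have Qne: "Q a b \<noteq> []" if ab: "(a, b) \<in> F" for a b
    using Dne[of b] Dne[of a] ab pathsD(1,3)[OF p ab] by (auto simp: Q_def)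
  have shape: "shape C F Q"
    unfolding shape_def
  proof (intro conjI allI impI)
    show "F \<subseteq> E" "sym F" by fact+
    fix a b assume ab: "(a, b) \<in> F"
    show "Q a b \<noteq> []" by (rule Qne[OF ab])
    show "Q b a = rev (Q a b)" by (rule Qrev[OF ab])
    show "set (Q a b) \<subseteq> V - C" using Qsub[OF ab] pathsD(6,7)[OF p ab] by blast
    have D: "distinct (D n) \<and> successively adj (D n)" if "(y, n) \<in> F" for n
      using pathsD(4,5)[OF p that] by (simp add: TD successively_append_iff)
    have "distinct (Q a b) \<and> successively adj (Q a b)"
    proof (cases "a = y")
      case True then show ?thesis using D ab by (simp add: Qy)
    next
      case False
      then show ?thesis using D[of a] pathsD(1,4,5)[OF p ab] successively_adj_rev
        by (cases "b = y") (simp_all add: Q_def del: successively_rev)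
    qed
    then show "distinct (Q a b)" "successively adj (Q a b)" by auto
  qed
  have meets: "meets F Q"
    unfolding meets_def
  proof (intro allI impI)
    fix a b a' b' w
    assume ab: "(a, b) \<in> F" and ab': "(a', b') \<in> F" and w: "w \<in> set (Q a b)" "w \<in> set (Q a' b')"
    have setQ_eq: "set (Q l m) = set (Q x x')" "(l, m) \<in> F" if e: "{l, m} = {x, x'}" "(x, x') \<in> F" for l m x x'
    proof -
      consider "l = x" "m = x'" | "l = x'" "m = x" using e(1) by (auto simp: doubleton_eq_iff)
      then show "set (Q l m) = set (Q x x')" "(l, m) \<in> F"
        by (cases; use Qrev[OF e(2)] e(2) pathsD(1)[OF p e(2)] in simp)+
    qed
    have "w \<in> set (P a b)" "w \<in> set (P a' b')" using w Qsub ab ab' by blast+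
    from paths_meet[OF p ab ab' this]
    show "{a, b} = {a', b'} \<or> (\<exists>l m n. {l, m} = {a, b} \<and> {l, n} = {a', b'} \<and> hd (Q l m) = w \<and> hd (Q l n) = w)"
    proof (elim disjE exE conjE)
      fix l m n assume l: "{l, m} = {a, b}" "{l, n} = {a', b'}" "hd (P l m) = w" "hd (P l n) = w"
      have "hd (Q l m) = w" using hdQ'[OF setQ_eq(2)[OF l(1) ab] l(3)] setQ_eq(1)[OF l(1) ab] w(1) by simp
      moreover have "hd (Q l n) = w" using hdQ'[OF setQ_eq(2)[OF l(2) ab'] l(4)] setQ_eq(1)[OF l(2) ab'] w(2) by simp
      ultimately show ?thesis using l(1,2) by blast
    qed simp
  qed
  have guarded: "guarded C F Q"
    unfolding guarded_def
  proof (intro allI impI)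
    fix a b w assume ab: "(a, b) \<in> F" and w: "w \<in> C"
    have "card (set (Q a b) \<inter> reach r C w) \<le> card (set (P a b) \<inter> reach r C w)"
      by (rule card_mono) (use Qsub[OF ab] in auto)
    then show "card (set (Q a b) \<inter> reach r C w) \<le> 2 * r + 1" using paths_card[OF p ab w] by simp
  qed
  have paths: "paths C F Q" using shape meets guarded by (simp add: paths_def)
  have T_sub: "set (T n) \<subseteq> set (P y n)" for n by (auto simp: TD)
  have K'x: "K' x = K x" if "x \<noteq> y" for x using that by (simp add: K'_def)
  have K'y: "K' y = K y \<union> (\<Union>n \<in> N. set (T n))" by (simp add: K'_def)
  have N: "n \<in> N \<longleftrightarrow> (y, n) \<in> F" for n by (simp add: N_def)
  have Tconn: "conn (set (T n))" if "T n \<noteq> []" "n \<in> N" for n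
    using that pathsD(5)[OF p, of y n] by (intro conn_list) (simp_all add: N TD successively_append_iff)
  \<comment> \<open>A vertex of the removed beginning could lie on another path at \<open>y\<close>
    only as its first vertex. Being unattached, it was cut off there too.\<close>
  have T_out: "u \<notin> set (Q a b)" if u: "u \<in> set (T n)" "n \<in> N" and ab: "(a, b) \<in> F" for u n a b
  proof
    assume uQ: "u \<in> set (Q a b)"
    have n: "(y, n) \<in> F" using u N by simp
    have "u \<in> set (P y n)" "u \<in> set (P a b)" using u T_sub Qsub[OF ab] uQ by blast+
    from paths_meet[OF p n ab this] show False
    proof (elim disjE exE conjE)
      assume "{y, n} = {a, b}"
      then have "u \<in> set (D n)" using uQ setQ[OF ab, of n] by simp
      then show False using TDdist[OF n] u by blast
    next
      fix l m m' assume l: "{l, m} = {y, n}" "{l, m'} = {a, b}" "hd (P l m) = u" "hd (P l m') = u"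
      show False
      proof (cases "l = y")
        case True
        then have m': "(y, m') \<in> F" using set_paths_eq(2)[OF p ab] l by blast
        then have uD: "u \<in> set (D m')" using uQ setQ[OF ab, of m'] l True by simp
        show False
        proof (cases "T m' = []")
          case True
          then have "u = hd (D m')" using l \<open>l = y\<close> TD[of m'] by simp
          then show False using Dhd[OF m'] Tun u by blast
        next
          case False
          then have "u \<in> set (T m')" using T_hd[OF False] l \<open>l = y\<close> by (metis hd_in_set)
          then show False using TDdist[OF m'] uD by blast
        qed
      next
        case False
        then have lm: "l = n" "m = y" using l(1) by (auto simp: doubleton_eq_iff)
        have "u = last (P y n)" using l(3) lm pathsD(3,8)[OF p n] by (simp add: hd_rev)
        then have "u \<in> set (D n)" using last_D[OF n] Dne[OF n] by (metis last_in_set)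
        then show False using TDdist[OF n] u by blast
      qed
    qed
  qed
  \<comment> \<open>With an empty core all paths at \<open>y\<close> share their first vertex, so
    either none of them is trimmed or that vertex lies in every removed beginning and makes their
    union connected.\<close>
  have allT: "\<And>m. m \<in> N \<Longrightarrow> T m = []" if "K y = {}" "n \<in> N" "T n = []" for n
  proof -
    fix m assume m: "m \<in> N"
    have "hd (P y m) = hd (P y n)" using coresD(6)[OF c that(1)] m that N by blast
    moreover have "\<not> un (hd (P y n))" using Dhd[of n] that TD[of n] N by simp
    ultimately show "T m = []" using D_eq(1)[of m] m N by simp
  qed
  have cores: "cores C F Q K'"
  proof (rule coresI)
    fix x
    have Ty: "set (T n) \<subseteq> V" "set (T n) \<inter> C = {}" if "n \<in> N" for n
      using T_sub[of n] pathsD(6,7)[OF p, of y n] that N by blast+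
    show "K' x \<subseteq> V" using coresD(1)[OF c] Ty(1) by (cases "x = y") (auto simp: K'x K'y)
    show "K' x \<inter> C = {}" using coresD(2)[OF c] Ty(2) by (cases "x = y") (auto simp: K'x K'y)
    show "conn (K' x)" if ne: "K' x \<noteq> {}"
    proof (cases "x = y")
      case False then show ?thesis using coresD(3)[OF c] ne by (simp add: K'x)
    next
      case x: True
      show ?thesis
      proof (cases "K y = {}")
        case True
        then obtain n where n: "n \<in> N" "T n \<noteq> []" using ne x K'y by auto
        define h where "h = hd (P y n)"
        have h: "T m \<noteq> [] \<and> h \<in> set (T m)" if "m \<in> N" for m
        proof -
          have "T m \<noteq> []" using allT[OF True that] n by blast
          moreover have "hd (P y m) = h" unfolding h_def using coresD(6)[OF c True] that n N by blast
          ultimately show ?thesis using T_hd[of m] by (metis hd_in_set)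
        qed
        have "conn ({h} \<union> (\<Union>m \<in> N. set (T m)))"
          by (rule conn_touching_Union) (use conn_singleton h Tconn in blast)+
        moreover have "{h} \<union> (\<Union>m \<in> N. set (T m)) = K' y" using True h[OF n(1)] n(1) K'y by auto
        ultimately show ?thesis using x by simp
      next
        case False
        have "conn (K y \<union> (\<Union>m \<in> N. set (T m)))"
        proof (rule conn_touching_Union)
          show "conn (K y)" using coresD(3)[OF c False] .
          fix m assume m: "m \<in> N"
          show "set (T m) = {} \<or> conn (set (T m)) \<and> (\<exists>a \<in> set (T m). \<exists>k \<in> K y. a = k \<or> adj k a)"
          proof (cases "T m = []")
            case ne: False
            obtain k where "k \<in> K y" "adj k (hd (P y m))" using coresD(7)[OF c False] m N by blast
            then show ?thesis using Tconn[OF ne m] T_hd[OF ne] hd_in_set[OF ne] by metis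
          qed simp
        qed
        then show ?thesis using x K'y by simp
      qed
    qed
    show "K' x \<inter> K' x' = {}" if "x \<noteq> x'" for x'
    proof -
      have "K z \<inter> set (T n) = {}" if "n \<in> N" for z n
        using coresD(5)[OF c, of y n z] T_sub[of n] that N by blast
      then show ?thesis using coresD(4)[OF c that] that
        by (cases "x = y"; cases "x' = y") (auto simp: K'x K'y)
    qed
    show "K' x \<inter> set (Q a b) = {}" if ab: "(a, b) \<in> F" for a b
      using coresD(5)[OF c ab, of x] Qsub[OF ab] T_out[OF _ _ ab]
      by (cases "x = y") (auto simp: K'x K'y)
    show "hd (Q x a) = hd (Q x b)" if e: "K' x = {}" and a: "(x, a) \<in> F" and b: "(x, b) \<in> F" for a b
    proof (cases "x = y")
      case True
      then have "K y = {}" "T a = []" "T b = []" using e a b K'y N by auto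
      then show ?thesis using coresD(6)[OF c _ , of y a b] a b True TD[of a] TD[of b] by (simp add: Qy)
    next
      case False
      then show ?thesis using coresD(6)[OF c, of x a b] e a b hdQ[OF False] by (simp add: K'x)
    qed
    show "\<exists>k \<in> K' x. adj k (hd (Q x n))" if ne: "K' x \<noteq> {}" and n: "(x, n) \<in> F" for n
    proof (cases "x = y")
      case False
      then show ?thesis using coresD(7)[OF c _ n] ne hdQ[OF False n] by (simp add: K'x)
    next
      case x: True
      then have yn: "(y, n) \<in> F" and nN: "n \<in> N" using n N by auto
      show ?thesis
      proof (cases "T n = []")
        case True
        have "K y \<noteq> {}" using allT[OF _ nN True] ne x K'y by auto
        then show ?thesis using coresD(7)[OF c _ yn] True TD[of n] x by (auto simp: Qy K'y)
      next
        case False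
        then have "adj (last (T n)) (hd (D n))"
          using pathsD(5)[OF p yn] Dne[OF yn] by (simp add: TD successively_append_iff)
        moreover have "last (T n) \<in> K' y" using last_in_set[OF False] nN K'y by blast
        ultimately show ?thesis using x by (auto simp: Qy)
      qed
    qed
  qed
  have isos: "isos C F Q K' I U"
  proof (rule isosI)
    show "I \<subseteq> Iso" "inj_on U I" "U ` I \<subseteq> V" "U ` I \<inter> C = {}" by (fact isosD[OF i])+
    show "K' x \<inter> U ` I = {}" for x
    proof (cases "x = y")
      case True
      have "set (T n) \<inter> U ` I = {}" if "n \<in> N" for n
        using isosD(6)[OF i, of y n] T_sub[of n] that N by blast
      then show ?thesis using isosD(5)[OF i, of y] K'y True by auto
    next
      case False then show ?thesis using isosD(5)[OF i, of x] by (simp add: K'x)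
    qed
    show "set (Q a b) \<inter> U ` I = {}" if "(a, b) \<in> F" for a b
      using isosD(6)[OF i that] Qsub[OF that] by blast
  qed
  have mem: "u \<in> set (Q a b) \<longleftrightarrow> u \<in> set (P a b)" if "(a, b) \<in> F" "attached C u" for a b u
    using Qatt[OF that(1)] that(2) by blast
  have "covers C F Q I U"
    unfolding covers_def using stateD(7)[OF st] mem unfolding covers_def by blast
  moreover have "has_private C F Q"
    unfolding has_private_def
  proof (intro allI impI)
    fix a b assume ab: "(a, b) \<in> F"
    obtain u where u: "u \<in> set (P a b)" "attached C u"
      "\<forall>c d. (c, d) \<in> F \<longrightarrow> u \<in> set (P c d) \<longrightarrow> {c, d} = {a, b}"
      by (rule has_privateD[OF stateD(8)[OF st] ab])
    then show "\<exists>u \<in> set (Q a b). attached C u \<and> (\<forall>c d. (c, d) \<in> F \<longrightarrow> u \<in> set (Q c d) \<longrightarrow> {c, d} = {a, b})"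
      using mem ab by blast
  qed
  ultimately have "state C F Q K' I U"
    using paths cores isos stateD(1,2,9)[OF st] by (simp add: state_def model_def)
  then show thesis
    by (rule that) (use Dhd hdQ Qatt in \<open>simp_all add: Qy un_def\<close>)
qed

text \<open>Excludes the other way to meet, at the far label \<open>m\<close>. There the first
  vertex of \<open>P y m\<close> would also be its last, hence its only vertex and therefore
  private.\<close>

lemma hd_shared:
  assumes st: "state C F P K I U" and ym: "(y, m) \<in> F" and ab: "(a, b) \<in> F"
    and q: "hd (P y m) \<in> set (P a b)"
  shows "\<exists>n. {a, b} = {y, n} \<and> hd (P y n) = hd (P y m)"
proof -
  note p = stateD(4)[OF st]
  let ?q = "hd (P y m)"
  have "?q \<in> set (P y m)" using pathsD(3)[OF p ym] by simp
  from paths_meet[OF p ym ab this q] show ?thesis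
  proof (elim disjE exE conjE)
    assume "{y, m} = {a, b}" then show ?thesis by blast
  next
    fix l m' n assume l: "{l, m'} = {y, m}" "{l, n} = {a, b}" "hd (P l m') = ?q" "hd (P l n) = ?q"
    show ?thesis
    proof (cases "l = y")
      case True
      have "{a, b} = {y, n} \<and> hd (P y n) = ?q" using l(2,4) True by simp
      then show ?thesis ..
    next
      case False
      then have lm: "l = m" "m' = y" using l(1) by (auto simp: doubleton_eq_iff)
      have "last (P y m) = ?q" using l(3) lm pathsD(3,8)[OF p ym] by (simp add: hd_rev)
      obtain q xs where xs: "P y m = q # xs" using pathsD(3)[OF p ym] by (cases "P y m") auto
      then have q': "?q = q" by simp
      have "xs = []"
      proof (rule ccontr)
        assume "xs \<noteq> []"
        then have "last xs = q" using \<open>last (P y m) = ?q\<close> unfolding q' xs by simp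
        then have "q \<in> set xs" using last_in_set[OF \<open>xs \<noteq> []\<close>] by simp
        then show False using pathsD(4)[OF p ym] unfolding xs by simp
      qed
      then have s: "set (P y m) = {?q}" unfolding q' xs by simp
      obtain u where u: "u \<in> set (P y m)" "attached C u"
        "\<forall>c d. (c, d) \<in> F \<longrightarrow> u \<in> set (P c d) \<longrightarrow> {c, d} = {y, m}"
        by (rule has_privateD[OF stateD(8)[OF st] ym])
      have "u = ?q" using u(1) s by blast
      then have "{a, b} = {y, m}" using u(3) ab q by blast
      then show ?thesis by blast
    qed
  qed
qed

section \<open>Extending a partial model\<close>

definition uedges :: "'c rel \<Rightarrow> 'c set set" where
  "uedges F = {{x, y} | x y. (x, y) \<in> F}"

definition bound :: nat where
  "bound = card (uedges E) * (2 * r + 1) + card Iso"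

definition good :: "'a set \<Rightarrow> bool" where
  "good C \<longleftrightarrow> (\<exists>F P K I U. state C F P K I U)"

text \<open>\<open>Q\<close> is the set ordered next. Its internal order is left open, so all
  reached vertices of \<open>Q\<close> are counted. The sets \<open>D\<close> in the last clause are
  the components of \<open>C - Q\<close>.\<close>

definition progress :: "'a set \<Rightarrow> 'a set \<Rightarrow> bool" where
  "progress C Q \<longleftrightarrow> Q \<noteq> {} \<and> Q \<subseteq> C \<and>
    (\<forall>w \<in> Q. card ((reach r C w - C) \<union> (Q \<inter> insert w (reach r C w))) \<le> bound) \<and>
    (\<forall>D. conn D \<longrightarrow> D \<subseteq> C - Q \<longrightarrow> (\<forall>u \<in> C - Q. attached D u \<longrightarrow> u \<in> D) \<longrightarrow> good D)"

section \<open>Counting the reached vertices\<close>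

lemma finite_uedges: "F \<subseteq> E \<Longrightarrow> finite (uedges F)"
proof -
  assume "F \<subseteq> E"
  then have "finite ((\<lambda>(x, y). {x, y}) ` F)" using finite_E finite_subset by blast
  moreover have "uedges F = (\<lambda>(x, y). {x, y}) ` F" by (auto simp: uedges_def)
  ultimately show ?thesis by simp
qed

lemma card_uedges_less:
  assumes "F \<subseteq> E" "sym F" "(y, z) \<in> E" "(y, z) \<notin> F"
  shows "card (uedges F) < card (uedges E)"
proof (rule psubset_card_mono)
  show "finite (uedges E)" by (rule finite_uedges) simp
  have "{y, z} \<in> uedges E" using assms(3) by (auto simp: uedges_def)
  moreover have "{y, z} \<notin> uedges F"
  proof
    assume "{y, z} \<in> uedges F"
    then obtain a b where "(a, b) \<in> F" "{y, z} = {a, b}" by (auto simp: uedges_def)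
    then show False using assms(2,4) by (metis doubleton_eq_iff symD)
  qed
  moreover have "uedges F \<subseteq> uedges E" using assms(1) by (auto simp: uedges_def)
  ultimately show "uedges F \<subset> uedges E" by blast
qed

lemma card_reach_paths:
  assumes p: "paths C F P" and w: "w \<in> C"
  shows "card (\<Union>(x, y) \<in> F. set (P x y) \<inter> reach r C w) \<le> card (uedges F) * (2 * r + 1)"
proof -
  \<comment> \<open>Both arcs of an edge carry the same vertex set, so grouping by unordered edges
    avoids a factor of two.\<close>
  define T where "T e = (\<Union>(x, y) \<in> {(x, y). (x, y) \<in> F \<and> {x, y} = e}. set (P x y) \<inter> reach r C w)" for e
  have fin: "finite (uedges F)" by (rule finite_uedges[OF pathsD_sub(1)[OF p]])
  have T: "finite (T e) \<and> card (T e) \<le> 2 * r + 1" if "e \<in> uedges F" for e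
  proof -
    obtain x y where xy: "(x, y) \<in> F" "e = {x, y}" using \<open>e \<in> uedges F\<close> by (auto simp: uedges_def)
    have "T e \<subseteq> set (P x y) \<inter> reach r C w"
    proof
      fix u assume "u \<in> T e"
      then obtain a b where ab: "{a, b} = {x, y}" "u \<in> set (P a b)" "u \<in> reach r C w" using xy(2) by (auto simp: T_def)
      then show "u \<in> set (P x y) \<inter> reach r C w" using set_paths_eq(1)[OF p xy(1) ab(1)] by simp
    qed
    moreover have "finite (set (P x y) \<inter> reach r C w)" by simp
    ultimately show ?thesis
      using paths_card[OF p xy(1) w] by (meson card_mono finite_subset le_trans)
  qed
  have "(\<Union>(x, y) \<in> F. set (P x y) \<inter> reach r C w) \<subseteq> (\<Union>e \<in> uedges F. T e)"
  proof (clarify)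
    fix u x y assume "(x, y) \<in> F" "u \<in> set (P x y)" "u \<in> reach r C w"
    then have "u \<in> T {x, y}" "{x, y} \<in> uedges F" by (auto simp: T_def uedges_def)
    then show "u \<in> (\<Union>e \<in> uedges F. T e)" by blast
  qed
  then have "card (\<Union>(x, y) \<in> F. set (P x y) \<inter> reach r C w) \<le> card (\<Union>e \<in> uedges F. T e)"
    using fin T by (intro card_mono) auto
  also have "\<dots> \<le> (\<Sum>e \<in> uedges F. card (T e))" by (rule card_UN_le[OF fin])
  also have "\<dots> \<le> (\<Sum>e \<in> uedges F. 2 * r + 1)" using T by (intro sum_mono) blast
  finally show ?thesis by simp
qed

text \<open>\<open>X\<close> leaves room for an attached vertex whose path is not counted in
  \<open>F\<close>; it is empty except when the path of a leaf edge is replaced.\<close>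

lemma card_reach:
  assumes p: "paths C F P" and I: "I \<subseteq> Iso" and w: "w \<in> C" and X: "finite X"
    and sub: "reach r C w - C \<subseteq> X \<union> U ` I \<union> (\<Union>(x, y) \<in> F. set (P x y))"
  shows "card (reach r C w - C) \<le> card X + card I + card (uedges F) * (2 * r + 1)"
proof -
  let ?A = "\<Union>(x, y) \<in> F. set (P x y) \<inter> reach r C w"
  have finI: "finite I" using I finite_Iso by (rule finite_subset)
  have finA: "finite ?A" using reach_subset_V finite_V by (intro finite_subset[of ?A V]) blast+
  have "reach r C w - C \<subseteq> X \<union> U ` I \<union> ?A" using sub by blast
  then have "card (reach r C w - C) \<le> card (X \<union> U ` I \<union> ?A)"
    using X finI finA by (intro card_mono) auto
  also have "\<dots> \<le> card X + card (U ` I) + card ?A" by (meson add_le_mono1 card_Un_le le_trans)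
  also have "\<dots> \<le> card X + card I + card (uedges F) * (2 * r + 1)"
    using card_image_le[OF finI, of U] card_reach_paths[OF p w] by simp
  finally show ?thesis .
qed

lemma state_reach:
  assumes st: "state C F P K I U" and w: "w \<in> C"
  shows "reach r C w - C \<subseteq> U ` I \<union> (\<Union>(x, y) \<in> F. set (P x y))"
proof
  fix u assume u: "u \<in> reach r C w - C"
  then have "attached C u" "u \<in> V - C" using attached_reach[of u r C w] w reach_subset_V by blast+
  then have "u \<in> U ` I \<or> (\<exists>x y. (x, y) \<in> F \<and> u \<in> set (P x y))"
    using stateD(7)[OF st] unfolding covers_def by simp
  then show "u \<in> U ` I \<union> (\<Union>(x, y) \<in> F. set (P x y))" by blast
qed

text \<open>One extended model serves all components \<open>D\<close> of \<open>C - Q\<close>. A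
  vertex attached to \<open>D\<close> but outside it lies in \<open>Q\<close>, where it is newly
  covered, or outside \<open>C\<close>, where it is attached to \<open>C\<close> and was covered
  before.\<close>

lemma progressI:
  assumes st: "state C F P K I U"
    and Q: "Q \<noteq> {}" "Q \<subseteq> C"
    and b: "\<And>w. w \<in> Q \<Longrightarrow> card (reach r C w - C) + card (Q \<inter> insert w (reach r C w)) \<le> bound"
    and model: "model (C - Q) F' P' K' I' U'"
    and U: "U ` I \<subseteq> U' ` I'"
    and P: "\<And>x y u. (x, y) \<in> F \<Longrightarrow> u \<in> set (P x y) \<Longrightarrow> attached C u \<Longrightarrow> \<exists>a b. (a, b) \<in> F' \<and> u \<in> set (P' a b)"
    and new: "\<And>u. u \<in> Q \<Longrightarrow> u \<in> U' ` I' \<or> (\<exists>a b. (a, b) \<in> F' \<and> u \<in> set (P' a b))"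
  shows "progress C Q"
  unfolding progress_def
proof (intro conjI ballI allI impI)
  show "Q \<noteq> {}" "Q \<subseteq> C" by fact+
  fix w assume "w \<in> Q"
  then show "card ((reach r C w - C) \<union> (Q \<inter> insert w (reach r C w))) \<le> bound"
    using b[of w] card_Un_le le_trans by blast
next
  fix D assume D: "conn D" "D \<subseteq> C - Q" "\<forall>u \<in> C - Q. attached D u \<longrightarrow> u \<in> D"
  have "covers D F' P' I' U'"
    unfolding covers_def
  proof (intro ballI impI)
    fix u assume u: "u \<in> V - D" "attached D u"
    show "u \<in> U' ` I' \<or> (\<exists>a b. (a, b) \<in> F' \<and> u \<in> set (P' a b))"
    proof (cases "u \<in> C")
      case True
      then have "u \<in> Q" using D(3) u by blast
      then show ?thesis by (rule new)
    next
      case False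
      have "attached C u" using u(2) D(2) by (auto simp: attached_def)
      then have "u \<in> U ` I \<or> (\<exists>x y. (x, y) \<in> F \<and> u \<in> set (P x y))"
        using stateD(7)[OF st] u(1) False unfolding covers_def by blast
      then show ?thesis using U P \<open>attached C u\<close> by blast
    qed
  qed
  moreover have "model D F' P' K' I' U'" by (rule model_shrink[OF model D(2)])
  moreover have "D \<subseteq> V" using D(2) stateD(2)[OF st] by blast
  ultimately show "good D" using state_of_covers[OF D(1)] unfolding good_def by blast
qed

section \<open>Removing vertices to realise an edge or an isolated vertex\<close>

lemma card_I_le: "isos C F P K I U \<Longrightarrow> card I \<le> card Iso"
  using isosD(1) finite_Iso card_mono by metis

text \<open>An edge missing among the \<open>n\<close> realised ones leaves a share of
  \<open>2 * r + 1\<close> unspent; it pays for the \<open>l\<close> additional vertices.\<close>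

lemma edge_bound:
  assumes "n < card (uedges E)" "m \<le> card Iso" "k \<le> m + n * (2 * r + 1)" "l \<le> 2 * r + 1"
  shows "k + l \<le> bound"
proof -
  have "(n + 1) * (2 * r + 1) \<le> card (uedges E) * (2 * r + 1)" using assms(1) by (intro mult_le_mono1) simp
  then show ?thesis using assms unfolding bound_def by (simp add: algebra_simps)
qed

text \<open>Both labels have paths already. After trimming at both, their first vertices
  \<open>q\<close> and \<open>q'\<close> are attached and are joined by a shortest bridge through
  \<open>C\<close>. The new path contains \<open>q\<close> and \<open>q'\<close>, but only its inner
  part is newly ordered.\<close>

lemma progress_bridge:
  assumes st0: "state C F P0 K0 I U" and yz: "(y, z) \<in> E" "(y, z) \<notin> F"
    and m: "(y, m) \<in> F" and n: "(z, n) \<in> F"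
  shows "\<exists>Q. progress C Q"
proof -
  have neq: "y \<noteq> z" using yz irrefl_E by blast
  obtain P1 K1 where 1: "state C F P1 K1 I U" "\<And>n. (y, n) \<in> F \<Longrightarrow> attached C (hd (P1 y n))"
    by (rule state_trim[OF st0, of y]) blast
  obtain P K where st: "state C F P K I U" and z_att: "\<And>n. (z, n) \<in> F \<Longrightarrow> attached C (hd (P z n))"
    and hd_eq: "\<And>x n. x \<noteq> z \<Longrightarrow> (x, n) \<in> F \<Longrightarrow> hd (P x n) = hd (P1 x n)"
    by (rule state_trim[OF 1(1), of z]) blast
  have y_att: "attached C (hd (P y n))" if "(y, n) \<in> F" for n using 1(2)[OF that] hd_eq[OF neq that] by simp
  note p = stateD(4)[OF st] and c = stateD(5)[OF st] and i = stateD(6)[OF st]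
  have F: "F \<subseteq> E" "sym F" using pathsD_sub[OF p] by auto
  have zyF: "(z, y) \<notin> F" using yz(2) F(2) by (meson symD)
  define q where "q = hd (P y m)"
  define q' where "q' = hd (P z n)"
  have qP: "q \<in> set (P y m)" "q' \<in> set (P z n)" using pathsD(3)[OF p m] pathsD(3)[OF p n] by (auto simp: q_def q'_def)
  have qC: "q \<notin> C" "q' \<notin> C" "q \<in> V" "q' \<in> V" using qP pathsD(6,7)[OF p m] pathsD(6,7)[OF p n] by blast+
  \<comment> \<open>A common first vertex would force a path at \<open>z\<close> to be a path at
    \<open>y\<close> as well, so the edge would already be realised.\<close>
  have "q \<noteq> q'"
  proof
    assume "q = q'"
    then obtain k where k: "{z, n} = {y, k}" using hd_shared[OF st m n] qP(2) q_def by auto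
    then have "n = y" using neq by (auto simp: doubleton_eq_iff)
    then show False using n zyF by simp
  qed
  obtain L where L: "L \<noteq> []" "set L \<subseteq> C" "distinct (q # L @ [q'])" "successively adj (q # L @ [q'])"
    "\<And>w D. w \<in> D \<Longrightarrow> D \<subseteq> C \<Longrightarrow> card (set (q # L @ [q']) \<inter> reach r D w) \<le> 2 * r + 1"
    "\<And>w. w \<in> set L \<Longrightarrow> card (set L \<inter> insert w (reach r C w)) \<le> 2 * r + 1"
    using geodesic_bridge[OF stateD(1)[OF st] _ qC(1) _ qC(2) \<open>q \<noteq> q'\<close>, of r] y_att[OF m] z_att[OF n]
    unfolding q_def[symmetric] q'_def[symmetric] by metis
  let ?L = "q # L @ [q']"
  let ?P = "\<lambda>a b. if a = y \<and> b = z then ?L else if a = z \<and> b = y then rev ?L else P a b"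
  let ?F = "F \<union> {(y, z), (z, y)}"
  have inL: "w = q \<or> w = q'" if "w \<in> set ?L" "w \<notin> C" for w using that L(2) by auto
  have "model (C - set L) ?F ?P K I U"
  proof (rule model_add_edge[OF stateD(3)[OF st] yz(1)])
    show "C - set L \<subseteq> C" by blast
    show "?L \<noteq> []" by simp
    show "distinct ?L" "successively adj ?L" by fact+
    show "set ?L \<subseteq> V - (C - set L)" using qC L(2) stateD(2)[OF st] by auto
    show "(y, z) \<notin> F" by fact
    show "w = hd ?L \<and> (\<exists>n. {a, b} = {y, n} \<and> hd (P y n) = w) \<or>
      w = last ?L \<and> (\<exists>n. {a, b} = {z, n} \<and> hd (P z n) = w)"
      if ab: "(a, b) \<in> F" "w \<in> set ?L" "w \<in> set (P a b)" for a b w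
    proof -
      have "w \<notin> C" using ab pathsD(7)[OF p ab(1)] by blast
      from inL[OF ab(2) this] show ?thesis
      proof
        assume "w = q"
        then show ?thesis using hd_shared[OF st m ab(1)] ab(3) by (simp add: q_def)
      next
        assume "w = q'"
        then show ?thesis using hd_shared[OF st n ab(1)] ab(3) by (simp add: q'_def)
      qed
    qed
    show "K x \<inter> set ?L = {}" for x
      using coresD(2)[OF c, of x] coresD(5)[OF c m, of x] coresD(5)[OF c n, of x] L(2) qP by auto
    show "U ` I \<inter> set ?L = {}"
      using isosD(4)[OF i] isosD(6)[OF i m] isosD(6)[OF i n] L(2) qP by auto
    show "hd (P y k) = hd ?L" if "K y = {}" "(y, k) \<in> F" for k
      using coresD(6)[OF c that(1,2) m] by (simp add: q_def)
    show "\<exists>k \<in> K y. adj k (hd ?L)" if "K y \<noteq> {}" using coresD(7)[OF c that m] by (simp add: q_def)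
    show "hd (P z k) = last ?L" if "K z = {}" "(z, k) \<in> F" for k
      using coresD(6)[OF c that(1,2) n] by (simp add: q'_def)
    show "\<exists>k \<in> K z. adj k (last ?L)" if "K z \<noteq> {}" using coresD(7)[OF c that n] by (simp add: q'_def)
    show "card (set ?L \<inter> reach r (C - set L) w) \<le> 2 * r + 1" if "w \<in> C - set L" for w
      by (rule L(5)[OF that]) blast
  qed
  then have "progress C (set L)"
  proof (rule progressI[OF st, rotated 3])
    show "set L \<noteq> {}" "set L \<subseteq> C" using L by auto
    show "U ` I \<subseteq> U ` I" by simp
    show "\<exists>a b. (a, b) \<in> ?F \<and> u \<in> set (?P a b)" if "(x, x') \<in> F" "u \<in> set (P x x')" for x x' u
    proof -
      have "\<not> (x = y \<and> x' = z)" "\<not> (x = z \<and> x' = y)" using that(1) yz(2) zyF by blast+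
      then have "u \<in> set (?P x x')" using that(2) by (simp only: if_False)
      moreover have "(x, x') \<in> ?F" using that(1) by simp
      ultimately show ?thesis by (intro exI conjI)
    qed
    show "u \<in> U ` I \<or> (\<exists>a b. (a, b) \<in> ?F \<and> u \<in> set (?P a b))" if "u \<in> set L" for u
    proof -
      have "(y, z) \<in> ?F \<and> u \<in> set (?P y z)" using that by simp
      then show ?thesis by (intro disjI2 exI)
    qed
    fix w assume w: "w \<in> set L"
    then have wC: "w \<in> C" using L(2) by blast
    show "card (reach r C w - C) + card (set L \<inter> insert w (reach r C w)) \<le> bound"
      by (rule edge_bound[OF card_uedges_less[OF F yz] card_I_le[OF i] _ L(6)[OF w]])
        (use card_reach[OF p isosD(1)[OF i] wC, of "{}" U] state_reach[OF st wC] in simp)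
  qed
  then show ?thesis ..
qed

lemma model_add_leaf:
  assumes model: "model C F P K I U" and yz: "(y, z) \<in> E" and z: "\<And>n. (z, n) \<notin> F"
    and C: "C \<subseteq> V" and u: "u \<in> C" and q: "q \<in> V - C" "adj q u" "q \<notin> U ` I" "\<And>x. q \<notin> K x"
    and qP: "\<And>a b. (a, b) \<in> F \<Longrightarrow> q \<in> set (P a b) \<Longrightarrow> \<exists>n. {a, b} = {y, n} \<and> hd (P y n) = q"
    and Ky: "\<And>n. K y = {} \<Longrightarrow> (y, n) \<in> F \<Longrightarrow> hd (P y n) = q"
      "K y \<noteq> {} \<Longrightarrow> \<exists>k \<in> K y. adj k q"
  shows "\<exists>F' P' K'. model (C - {u}) F' P' K' I U \<and>
    (\<forall>v. v = q \<or> v = u \<or> (\<exists>a b. (a, b) \<in> F \<and> v \<in> set (P a b)) \<longrightarrow> (\<exists>a b. (a, b) \<in> F' \<and> v \<in> set (P' a b)))"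
proof -
  let ?F = "F \<union> {(y, z), (z, y)}"
  let ?L = "[q, u]"
  let ?P = "\<lambda>a b. if a = y \<and> b = z then ?L else if a = z \<and> b = y then rev ?L else P a b"
  have p: "paths C F P" and c: "cores C F P K" and i: "isos C F P K I U" using model by (auto simp: model_def)
  have neq: "y \<noteq> z" using yz irrefl_E by blast
  have zF: "(n, z) \<notin> F" for n using z pathsD_sub(2)[OF p] by (meson symD)
  have uP: "u \<notin> set (P a b)" if "(a, b) \<in> F" for a b using pathsD(7)[OF p that] u by blast
  have "model (C - {u}) ?F ?P (K(z := {})) I U"
  proof (rule model_add_edge[OF model_reset_core[OF model z] yz])
    show "C - {u} \<subseteq> C" "?L \<noteq> []" "(y, z) \<notin> F" using zF by auto
    show "distinct ?L" "successively adj ?L" "set ?L \<subseteq> V - (C - {u})" using q u C by auto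
    show "w = hd ?L \<and> (\<exists>n. {a, b} = {y, n} \<and> hd (P y n) = w) \<or>
      w = last ?L \<and> (\<exists>n. {a, b} = {z, n} \<and> hd (P z n) = w)"
      if ab: "(a, b) \<in> F" "w \<in> set ?L" "w \<in> set (P a b)" for a b w
    proof -
      have "w = q" using ab uP[OF ab(1)] by auto
      then show ?thesis using qP[OF ab(1)] ab(3) by simp
    qed
    show "(K(z := {})) x \<inter> set ?L = {}" for x using q(4)[of x] coresD(2)[OF c, of x] u by auto
    show "U ` I \<inter> set ?L = {}" using q(3) isosD(4)[OF i] u by auto
    show "hd (P y n) = hd ?L" if "(K(z := {})) y = {}" "(y, n) \<in> F" for n
      using Ky(1)[OF _ that(2)] that(1) neq by simp
    show "\<exists>k \<in> (K(z := {})) y. adj k (hd ?L)" if "(K(z := {})) y \<noteq> {}" using Ky(2) that neq by simp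
    show "hd (P z n) = last ?L" if "(z, n) \<in> F" for n using z that by blast
    show "\<exists>k \<in> (K(z := {})) z. adj k (last ?L)" if "(K(z := {})) z \<noteq> {}" using that by simp
    \<comment> \<open>Two vertices are within the allowance because \<open>r\<close> is
      positive.\<close>
    show "card (set ?L \<inter> reach r (C - {u}) w) \<le> 2 * r + 1" for w
    proof -
      have "card (set ?L \<inter> reach r (C - {u}) w) \<le> card (set ?L)" by (rule card_mono) auto
      also have "\<dots> \<le> length ?L" by (rule card_length)
      finally show ?thesis using r_pos by simp
    qed
  qed
  moreover have "\<exists>a b. (a, b) \<in> ?F \<and> v \<in> set (?P a b)"
    if v: "v = q \<or> v = u \<or> (\<exists>a b. (a, b) \<in> F \<and> v \<in> set (P a b))" for v
  proof -
    consider "v \<in> set ?L" | a b where "(a, b) \<in> F" "v \<in> set (P a b)" using v by auto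
    then show ?thesis
    proof cases
      case 1
      then have "(y, z) \<in> ?F \<and> v \<in> set (?P y z)" by simp
      then show ?thesis by (intro exI)
    next
      case 2
      then have "\<not> (a = y \<and> b = z)" "\<not> (a = z \<and> b = y)" using z[of y] zF[of y] by blast+
      then have "v \<in> set (?P a b)" using 2(2) by (simp only: if_False)
      moreover have "(a, b) \<in> ?F" using 2(1) by simp
      ultimately show ?thesis by (intro exI conjI)
    qed
  qed
  ultimately show ?thesis by blast
qed

lemma singleton_own: "card ({u} \<inter> insert w (reach r C w)) \<le> 1"
proof -
  have "card ({u} \<inter> insert w (reach r C w)) \<le> card {u}" by (rule card_mono) auto
  then show ?thesis by simp
qed

lemma progress_leaf:
  assumes st0: "state C F P0 K0 I U" and yz: "(y, z) \<in> E"
    and m: "(y, m) \<in> F" and z: "\<And>n. (z, n) \<notin> F"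
  shows "\<exists>Q. progress C Q"
proof -
  obtain P K where st: "state C F P K I U" and att: "\<And>n. (y, n) \<in> F \<Longrightarrow> attached C (hd (P y n))"
    by (rule state_trim[OF st0, of y]) blast
  note p = stateD(4)[OF st] and c = stateD(5)[OF st] and i = stateD(6)[OF st]
  have F: "F \<subseteq> E" "sym F" using pathsD_sub[OF p] by auto
  have yzF: "(y, z) \<notin> F" using z F(2) by (meson symD)
  define q where "q = hd (P y m)"
  have qP: "q \<in> set (P y m)" using pathsD(3)[OF p m] by (auto simp: q_def)
  obtain u where u: "u \<in> C" "adj q u" using att[OF m] by (auto simp: attached_def q_def)
  have "\<exists>F' P' K'. model (C - {u}) F' P' K' I U \<and>
    (\<forall>v. v = q \<or> v = u \<or> (\<exists>a b. (a, b) \<in> F \<and> v \<in> set (P a b)) \<longrightarrow> (\<exists>a b. (a, b) \<in> F' \<and> v \<in> set (P' a b)))"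
  proof (rule model_add_leaf[OF stateD(3)[OF st] yz z stateD(2)[OF st] u(1) _ u(2)])
    show "q \<in> V - C" using qP pathsD(6,7)[OF p m] by blast
    show "q \<notin> U ` I" using qP isosD(6)[OF i m] by blast
    show "q \<notin> K x" for x using qP coresD(5)[OF c m, of x] by blast
    show "\<exists>n. {a, b} = {y, n} \<and> hd (P y n) = q" if "(a, b) \<in> F" "q \<in> set (P a b)" for a b
      using hd_shared[OF st m that(1)] that(2) by (simp add: q_def)
    show "hd (P y n) = q" if "K y = {}" "(y, n) \<in> F" for n
      using coresD(6)[OF c that m] by (simp add: q_def)
    show "\<exists>k \<in> K y. adj k q" if "K y \<noteq> {}" using coresD(7)[OF c that m] by (simp add: q_def)
  qed
  then obtain F' P' K' where model: "model (C - {u}) F' P' K' I U"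
    and cov: "\<And>v. v = q \<or> v = u \<or> (\<exists>a b. (a, b) \<in> F \<and> v \<in> set (P a b)) \<Longrightarrow> \<exists>a b. (a, b) \<in> F' \<and> v \<in> set (P' a b)"
    by blast
  have "progress C {u}"
  proof (rule progressI[OF st _ _ _ model])
    fix w assume "w \<in> {u}"
    then have wC: "w \<in> C" using u by simp
    show "card (reach r C w - C) + card ({u} \<inter> insert w (reach r C w)) \<le> bound"
      by (rule edge_bound[OF card_uedges_less[OF F yz yzF] card_I_le[OF i]])
        (use card_reach[OF p isosD(1)[OF i] wC, of "{}" U] state_reach[OF st wC] singleton_own[of u w C] in simp_all)
  qed (use u cov in blast)+
  then show ?thesis ..
qed

text \<open>With no path at either label, one vertex of \<open>C\<close> serves as the whole path,
  shared by both sides; both cores become empty.\<close>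

lemma progress_fresh_edge:
  assumes st: "state C F P K I U" and yz: "(y, z) \<in> E"
    and y: "\<And>n. (y, n) \<notin> F" and z: "\<And>n. (z, n) \<notin> F"
  shows "\<exists>Q. progress C Q"
proof -
  note p = stateD(4)[OF st] and c = stateD(5)[OF st] and i = stateD(6)[OF st]
  have F: "F \<subseteq> E" "sym F" using pathsD_sub[OF p] by auto
  obtain u where u: "u \<in> C" using stateD(1)[OF st] by (auto simp: conn_def)
  let ?F = "F \<union> {(y, z), (z, y)}"
  let ?L = "[u]"
  let ?P = "\<lambda>a b. if a = y \<and> b = z then ?L else if a = z \<and> b = y then rev ?L else P a b"
  let ?K = "K(y := {}, z := {})"
  have uP: "u \<notin> set (P a b)" if "(a, b) \<in> F" for a b using pathsD(7)[OF p that] u by blast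
  have "model (C - {u}) ?F ?P ?K I U"
  proof (rule model_add_edge[OF model_reset_core[OF model_reset_core[OF stateD(3)[OF st] y] z] yz])
    show "C - {u} \<subseteq> C" "?L \<noteq> []" "(y, z) \<notin> F" using y by auto
    show "distinct ?L" "successively adj ?L" "set ?L \<subseteq> V - (C - {u})" using u stateD(2)[OF st] by auto
    show "w = hd ?L \<and> (\<exists>n. {a, b} = {y, n} \<and> hd (P y n) = w) \<or>
      w = last ?L \<and> (\<exists>n. {a, b} = {z, n} \<and> hd (P z n) = w)"
      if ab: "(a, b) \<in> F" "w \<in> set ?L" "w \<in> set (P a b)" for a b w
      using ab uP[OF ab(1)] by auto
    show "?K x \<inter> set ?L = {}" for x using coresD(2)[OF c, of x] u by auto
    show "U ` I \<inter> set ?L = {}" using isosD(4)[OF i] u by auto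
    show "hd (P y n) = hd ?L" if "(y, n) \<in> F" for n using y that by blast
    show "\<exists>k \<in> ?K y. adj k (hd ?L)" if "?K y \<noteq> {}" using that by (simp split: if_splits)
    show "hd (P z n) = last ?L" if "(z, n) \<in> F" for n using z that by blast
    show "\<exists>k \<in> ?K z. adj k (last ?L)" if "?K z \<noteq> {}" using that by simp
    show "card (set ?L \<inter> reach r (C - {u}) w) \<le> 2 * r + 1" for w
    proof -
      have "card (set ?L \<inter> reach r (C - {u}) w) \<le> card (set ?L)" by (rule card_mono) auto
      then show ?thesis by simp
    qed
  qed
  then have "progress C {u}"
  proof (rule progressI[OF st, rotated 3])
    show "{u} \<noteq> {}" "{u} \<subseteq> C" "U ` I \<subseteq> U ` I" using u by auto
    show "\<exists>a b. (a, b) \<in> ?F \<and> v \<in> set (?P a b)" if "(x, x') \<in> F" "v \<in> set (P x x')" for x x' v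
    proof -
      have "\<not> (x = y \<and> x' = z)" "\<not> (x = z \<and> x' = y)" using that(1) y z by blast+
      then have "v \<in> set (?P x x')" using that(2) by (simp only: if_False)
      moreover have "(x, x') \<in> ?F" using that(1) by simp
      ultimately show ?thesis by (intro exI conjI)
    qed
    show "v \<in> U ` I \<or> (\<exists>a b. (a, b) \<in> ?F \<and> v \<in> set (?P a b))" if "v \<in> {u}" for v
    proof -
      have "(y, z) \<in> ?F \<and> v \<in> set (?P y z)" using that by simp
      then show ?thesis by (intro disjI2 exI)
    qed
    fix w assume "w \<in> {u}"
    then have wC: "w \<in> C" using u by simp
    show "card (reach r C w - C) + card ({u} \<inter> insert w (reach r C w)) \<le> bound"
      by (rule edge_bound[OF card_uedges_less[OF F yz y] card_I_le[OF i]])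
        (use card_reach[OF p isosD(1)[OF i] wC, of "{}" U] state_reach[OF st wC] singleton_own[of u w C] in simp_all)
  qed
  then show ?thesis ..
qed

lemma progress_edge:
  assumes st: "state C F P K I U" and yz: "(y, z) \<in> E" "(y, z) \<notin> F"
  shows "\<exists>Q. progress C Q"
proof -
  have zy: "(z, y) \<in> E" using yz(1) sym_E by (meson symD)
  consider m n where "(y, m) \<in> F" "(z, n) \<in> F" | m where "(y, m) \<in> F" "\<And>n. (z, n) \<notin> F"
    | n where "(z, n) \<in> F" "\<And>m. (y, m) \<notin> F" | "\<And>m. (y, m) \<notin> F" "\<And>n. (z, n) \<notin> F" by blast
  then show ?thesis
  proof cases
    case 1 then show ?thesis by (rule progress_bridge[OF st yz])
  next
    case 2 then show ?thesis by (rule progress_leaf[OF st yz(1)])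
  next
    case 3 then show ?thesis by (rule progress_leaf[OF st zy])
  next
    case 4 then show ?thesis by (rule progress_fresh_edge[OF st yz(1)])
  qed
qed

text \<open>Every realised edge and isolated vertex may already be in use apart from
  \<open>j\<close>, whose share of one pays for the removed vertex \<open>u\<close>.\<close>

lemma progress_iso:
  assumes st: "state C F P K I U" and j: "j \<in> Iso" "j \<notin> I"
  shows "\<exists>Q. progress C Q"
proof -
  note p = stateD(4)[OF st] and i = stateD(6)[OF st]
  have F: "F \<subseteq> E" using pathsD_sub[OF p] by auto
  obtain u where u: "u \<in> C" using stateD(1)[OF st] by (auto simp: conn_def)
  have "card I < card Iso" using isosD(1)[OF i] j finite_Iso by (intro psubset_card_mono) auto
  moreover have "card (uedges F) \<le> card (uedges E)"
    by (rule card_mono[OF finite_uedges]) (use F in \<open>auto simp: uedges_def\<close>)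
  then have "card (uedges F) * (2 * r + 1) \<le> card (uedges E) * (2 * r + 1)" by (rule mult_le_mono1)
  ultimately have b: "1 + card I + card (uedges F) * (2 * r + 1) \<le> bound" by (simp add: bound_def)
  have "progress C {u}"
  proof (rule progressI[OF st _ _ _ model_add_iso[OF stateD(3)[OF st] j u stateD(2)[OF st]]])
    fix w assume "w \<in> {u}"
    then have wC: "w \<in> C" using u by simp
    have "card (reach r C w - C) \<le> card I + card (uedges F) * (2 * r + 1)"
      using card_reach[OF p isosD(1)[OF i] wC, of "{}" U] state_reach[OF st wC] by simp
    then show "card (reach r C w - C) + card ({u} \<inter> insert w (reach r C w)) \<le> bound"
      using singleton_own[of u w C] b by linarith
  qed (use u j in \<open>auto\<close>)
  then show ?thesis ..
qed

text \<open>
  The path of a leaf edge that is attached in a single vertex \<open>q\<close> is replaced by \<open>q\<close> followed by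
  a neighbour of \<open>q\<close> in \<open>C\<close>. This costs two vertices, not more than the bound for an edge.
\<close>

lemma progress_single:
  assumes st0: "state C E P0 K0 I U" and yl: "(y, l) \<in> E" and leaf: "\<And>n. (l, n) \<in> E \<Longrightarrow> n = y"
    and single: "\<And>u v. u \<in> set (P0 l y) \<Longrightarrow> v \<in> set (P0 l y) \<Longrightarrow> attached C u \<Longrightarrow> attached C v \<Longrightarrow> u = v"
  shows "\<exists>Q. progress C Q"
proof -
  have ly: "(l, y) \<in> E" using yl sym_E by (meson symD)
  obtain P K where st: "state C E P K I U" and att: "\<And>n. (y, n) \<in> E \<Longrightarrow> attached C (hd (P y n))"
    and same: "\<And>a b. (a, b) \<in> E \<Longrightarrow> {u \<in> set (P a b). attached C u} = {u \<in> set (P0 a b). attached C u}"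
    by (rule state_trim[OF st0, of y]) blast
  note p = stateD(4)[OF st] and c = stateD(5)[OF st] and i = stateD(6)[OF st]
  define q where "q = hd (P y l)"
  have qP: "q \<in> set (P y l)" using pathsD(3)[OF p yl] by (auto simp: q_def)
  have qatt: "attached C q" using att[OF yl] by (simp add: q_def)
  have setly: "set (P l y) = set (P y l)" using pathsD(8)[OF p yl] by simp
  have only: "u = q" if "u \<in> set (P y l)" "attached C u" for u
    using single[of u q] same[OF ly] that qP qatt setly by blast
  \<comment> \<open>The path has a private attached vertex, and \<open>q\<close> is its only
    attached one.\<close>
  have priv: "{a, b} = {y, l}" if "(a, b) \<in> E" "q \<in> set (P a b)" for a b
  proof -
    obtain u where "u \<in> set (P y l)" "attached C u"
      "\<forall>c d. (c, d) \<in> E \<longrightarrow> u \<in> set (P c d) \<longrightarrow> {c, d} = {y, l}"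
      by (rule has_privateD[OF stateD(8)[OF st] yl])
    then show ?thesis using only that by blast
  qed
  obtain u where u: "u \<in> C" "adj q u" using qatt by (auto simp: attached_def)
  define F where "F = E - {(y, l), (l, y)}"
  have symF: "sym F" using sym_E unfolding F_def sym_def by blast
  have m0: "model C F P K I U" by (rule model_restrict[OF stateD(3)[OF st]]) (use symF in \<open>auto simp: F_def\<close>)
  then have p0: "paths C F P" by (simp add: model_def)
  have notF: "{a, b} \<noteq> {y, l}" if "(a, b) \<in> F" for a b using that by (auto simp: F_def doubleton_eq_iff)
  have FE: "(a, b) \<in> E" if "(a, b) \<in> F" for a b using that by (simp add: F_def)
  have "\<exists>F' P' K'. model (C - {u}) F' P' K' I U \<and>
    (\<forall>v. v = q \<or> v = u \<or> (\<exists>a b. (a, b) \<in> F \<and> v \<in> set (P a b)) \<longrightarrow> (\<exists>a b. (a, b) \<in> F' \<and> v \<in> set (P' a b)))"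
  proof (rule model_add_leaf[OF m0 yl _ stateD(2)[OF st] u(1) _ u(2)])
    show "(l, n) \<notin> F" for n using leaf by (auto simp: F_def)
    show "q \<in> V - C" using qP pathsD(6,7)[OF p yl] by blast
    show "q \<notin> U ` I" using qP isosD(6)[OF i yl] by blast
    show "q \<notin> K x" for x using qP coresD(5)[OF c yl, of x] by blast
    show "\<exists>n. {a, b} = {y, n} \<and> hd (P y n) = q" if "(a, b) \<in> F" "q \<in> set (P a b)" for a b
      using priv[OF FE[OF that(1)] that(2)] notF[OF that(1)] by blast
    show "hd (P y n) = q" if "K y = {}" "(y, n) \<in> F" for n
      using coresD(6)[OF c that(1) FE[OF that(2)] yl] by (simp add: q_def)
    show "\<exists>k \<in> K y. adj k q" if "K y \<noteq> {}" using coresD(7)[OF c that yl] by (simp add: q_def)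
  qed
  then obtain F' P' K' where model: "model (C - {u}) F' P' K' I U"
    and cov: "\<And>v. v = q \<or> v = u \<or> (\<exists>a b. (a, b) \<in> F \<and> v \<in> set (P a b)) \<Longrightarrow> \<exists>a b. (a, b) \<in> F' \<and> v \<in> set (P' a b)"
    by blast
  have old: "v = q \<or> (\<exists>a b. (a, b) \<in> F \<and> v \<in> set (P a b))" if ab: "(a, b) \<in> E" "v \<in> set (P a b)" "attached C v" for a b v
  proof (cases "(a, b) \<in> F")
    case False
    then have "v \<in> set (P y l)" using ab setly by (auto simp: F_def)
    then show ?thesis using only ab(3) by blast
  qed (use ab in blast)
  have "progress C {u}"
  proof (rule progressI[OF st _ _ _ model])
    fix w assume "w \<in> {u}"
    then have wC: "w \<in> C" using u by simp
    \<comment> \<open>Of the discarded path only \<open>q\<close> can be reached, so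
      \<open>q\<close> takes the place of a whole share.\<close>
    have "reach r C w - C \<subseteq> {q} \<union> U ` I \<union> (\<Union>(x, y) \<in> F. set (P x y))"
    proof
      fix v assume v: "v \<in> reach r C w - C"
      have "attached C v" using attached_reach[of v r C w] v wC by blast
      then show "v \<in> {q} \<union> U ` I \<union> (\<Union>(x, y) \<in> F. set (P x y))"
        using state_reach[OF st wC] v old[of _ _ v] by blast
    qed
    from card_reach[OF p0 isosD(1)[OF i] wC _ this]
    have k: "card (reach r C w - C) \<le> 1 + card I + card (uedges F) * (2 * r + 1)" by simp
    have "card (uedges F) < card (uedges E)"
      by (rule card_uedges_less[OF _ symF yl]) (auto simp: F_def)
    \<comment> \<open>The value 2 pays for \<open>q\<close> and \<open>u\<close>; it fits into one
      share since \<open>r\<close> is positive.\<close>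
    from edge_bound[OF this card_I_le[OF i] order_refl, of 2]
    show "card (reach r C w - C) + card ({u} \<inter> insert w (reach r C w)) \<le> bound"
      using k singleton_own[of u w C] r_pos by linarith
  next
    show "\<exists>a b. (a, b) \<in> F' \<and> v \<in> set (P' a b)" if "(a, b) \<in> E" "v \<in> set (P a b)" "attached C v" for a b v
      using old[OF that] cov by blast
    show "v \<in> U ` I \<or> (\<exists>a b. (a, b) \<in> F' \<and> v \<in> set (P' a b))" if "v \<in> {u}" for v using cov that by blast
  qed (use u in auto)
  then show ?thesis ..
qed

section \<open>Completing a full partial model to a minor\<close>

text \<open>A model of H with \<open>C\<close> in the role of v. As \<open>C\<close> touches every
  other branch set, it does not matter which neighbours v has in H.\<close>

definition touching_model :: "'a set \<Rightarrow> ('c \<Rightarrow> 'a set) \<Rightarrow> bool" where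
  "touching_model C B \<longleftrightarrow> conn C \<and> C \<subseteq> V \<and>
    (\<forall>x \<in> Field E \<union> Iso. conn (B x) \<and> B x \<subseteq> V - C \<and> (\<exists>a \<in> B x. attached C a)) \<and>
    disjoint_family_on B (Field E \<union> Iso) \<and>
    (\<forall>x y. (x, y) \<in> E \<longrightarrow> (\<exists>a \<in> B x. \<exists>b \<in> B y. adj a b))"

text \<open>
  \<open>P x y\<close> is cut into a part \<open>a\<close> for \<open>x\<close> and a part \<open>b\<close> for \<open>y\<close>. The branch set of \<open>x\<close> gets its
  connection to \<open>C\<close> from its part of \<open>P x (m x)\<close>.
\<close>

definition cut where
  "cut C P K m x y a b \<longleftrightarrow> P x y = a @ b \<and>
    (a = [] \<longrightarrow> K x \<noteq> {} \<and> (\<forall>c d. (c, d) \<in> E \<longrightarrow> {c, d} \<noteq> {x, y} \<longrightarrow> hd (P x y) \<notin> set (P c d))) \<and>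
    (b = [] \<longrightarrow> K y \<noteq> {} \<and> (\<forall>c d. (c, d) \<in> E \<longrightarrow> {c, d} \<noteq> {x, y} \<longrightarrow> last (P x y) \<notin> set (P c d))) \<and>
    (m x = y \<longrightarrow> (\<exists>u \<in> set a. attached C u)) \<and> (m y = x \<longrightarrow> (\<exists>u \<in> set b. attached C u))"

lemma cut_rev:
  assumes "paths C E P" "(x, y) \<in> E" "cut C P K m x y a b"
  shows "cut C P K m y x (rev b) (rev a)"
proof -
  have h: "hd (P y x) = last (P x y)" and l: "last (P y x) = hd (P x y)"
    using pathsD(3,8)[OF assms(1,2)] by (simp_all add: hd_rev last_rev)
  have r: "P y x = rev b @ rev a" using pathsD(8)[OF assms(1,2)] assms(3) by (simp add: cut_def)
  have e: "{y, x} = {x, y}" by blast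
  show ?thesis
    using r assms(3) unfolding cut_def h l e rev_is_Nil_conv set_rev by blast
qed

text \<open>If the path serves both ends, it is cut between two attached vertices. If it serves at
  most \<open>x\<close>, it is cut just behind its private attached vertex, which goes to
  \<open>x\<close>. The case that it serves only \<open>y\<close> is reduced to this one by
  reversal.\<close>

lemma cut_exists:
  assumes st: "state C E P K I U" and xy: "(x, y) \<in> E"
    and m: "\<And>x. x \<in> Field E \<Longrightarrow> (x, m x) \<in> E"
    and both: "m x = y \<Longrightarrow> m y = x \<Longrightarrow>
      \<exists>u v. u \<in> set (P x y) \<and> v \<in> set (P x y) \<and> attached C u \<and> attached C v \<and> u \<noteq> v"
    and not_only_y: "m y = x \<Longrightarrow> m x = y"
  shows "\<exists>a b. cut C P K m x y a b"
proof (cases "m y = x")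
  case True
  then obtain u v where uv: "u \<in> set (P x y)" "v \<in> set (P x y)" "attached C u" "attached C v" "u \<noteq> v"
    using both not_only_y by blast
  obtain p1 p2 where p: "P x y = p1 @ u # p2" using uv(1) by (meson split_list)
  consider "v \<in> set p1" | "v \<in> set p2" using p uv by auto
  then show ?thesis
  proof cases
    case 1
    then have "cut C P K m x y p1 (u # p2)" using uv p unfolding cut_def by auto
    then show ?thesis by blast
  next
    case 2
    then have "cut C P K m x y (p1 @ [u]) p2" using uv p unfolding cut_def by auto
    then show ?thesis by blast
  qed
next
  case False
  note p = stateD(4)[OF st] and c = stateD(5)[OF st]
  obtain u where u: "u \<in> set (P x y)" "attached C u"
    "\<forall>c d. (c, d) \<in> E \<longrightarrow> u \<in> set (P c d) \<longrightarrow> {c, d} = {x, y}"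
    by (rule has_privateD[OF stateD(8)[OF st] xy])
  obtain p1 p2 where P: "P x y = p1 @ u # p2" using u(1) by (meson split_list)
  \<comment> \<open>If \<open>y\<close> gets nothing and has no core, then every path at
    \<open>y\<close> starts in \<open>u\<close>. The path towards \<open>m y\<close>, which differs
    from \<open>x\<close>, would contradict that \<open>u\<close> is private.\<close>
  have "K y \<noteq> {}" if "p2 = []"
  proof
    assume "K y = {}"
    have yx: "(y, x) \<in> E" by (rule pathsD(1)[OF p xy])
    then have my: "(y, m y) \<in> E" using m[of y] by (auto intro: FieldI1)
    have "hd (P y x) = u" using P that pathsD(8)[OF p xy] by simp
    then have "hd (P y (m y)) = u" using coresD(6)[OF c \<open>K y = {}\<close> my yx] by simp
    then have "u \<in> set (P y (m y))" using pathsD(3)[OF p my] by auto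
    then have "{y, m y} = {x, y}" using u(3) my by blast
    then show False using False by (auto simp: doubleton_eq_iff)
  qed
  then have "cut C P K m x y (p1 @ [u]) p2"
    using u P False unfolding cut_def by auto
  then show ?thesis by blast
qed

lemma cuts_exist:
  assumes st: "state C E P K I U"
    and m: "\<And>x. x \<in> Field E \<Longrightarrow> (x, m x) \<in> E"
    and both: "\<And>x. x \<in> Field E \<Longrightarrow> m (m x) = x \<Longrightarrow>
      \<exists>u v. u \<in> set (P x (m x)) \<and> v \<in> set (P x (m x)) \<and> attached C u \<and> attached C v \<and> u \<noteq> v"
  shows "\<exists>R. \<forall>x y. (x, y) \<in> E \<longrightarrow> (\<exists>a b. cut C P K m x y a b \<and> R x y = set a \<and> R y x = set b)"
proof -
  note p = stateD(4)[OF st]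
  have sym: "(y, x) \<in> E" if "(x, y) \<in> E" for x y using that sym_E by (meson symD)
  have both': "\<exists>u v. u \<in> set (P x y) \<and> v \<in> set (P x y) \<and> attached C u \<and> attached C v \<and> u \<noteq> v"
    if "(x, y) \<in> E" "m x = y" "m y = x" for x y
    using both[of x] that by (auto intro: FieldI1)
  have ex: "\<exists>p. cut C P K m x y (fst p) (snd p)" if xy: "(x, y) \<in> E" for x y
  proof (cases "m y = x \<and> m x \<noteq> y")
    case True
    have "\<exists>a b. cut C P K m y x a b"
      by (rule cut_exists[OF st sym[OF xy] m]) (use True in auto)
    then show ?thesis using cut_rev[OF p sym[OF xy]] by (metis fst_conv snd_conv)
  next
    case False
    have "\<exists>a b. cut C P K m x y a b"
      by (rule cut_exists[OF st xy m both'[OF xy]]) (use False in auto)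
    then show ?thesis by (metis fst_conv snd_conv)
  qed
  define A where "A x y = (SOME p. cut C P K m x y (fst p) (snd p))" for x y
  have A: "cut C P K m x y (fst (A x y)) (snd (A x y))" if "(x, y) \<in> E" for x y
    unfolding A_def by (rule someI_ex[OF ex[OF that]])
  \<comment> \<open>One orientation is fixed for every edge, so that \<open>R x y\<close> and
    \<open>R y x\<close> come from the same cut.\<close>
  define g where "g e = (SOME x. x \<in> e)" for e :: "'c set"
  have g: "g {x, y} = x \<or> g {x, y} = y" for x y
    unfolding g_def by (metis (mono_tags) insert_iff singletonD someI)
  define R where "R x y = (if g {x, y} = x then set (fst (A x y)) else set (snd (A y x)))" for x y
  show ?thesis
  proof (intro exI[of _ R] allI impI)
    fix x y assume xy: "(x, y) \<in> E"
    then have neq: "x \<noteq> y" using irrefl_E by blast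
    show "\<exists>a b. cut C P K m x y a b \<and> R x y = set a \<and> R y x = set b"
    proof (cases "g {x, y} = x")
      case True
      then have "g {y, x} \<noteq> y" using neq by (simp add: insert_commute)
      then show ?thesis using True A[OF xy] by (auto simp: R_def)
    next
      case False
      then have "g {y, x} = y" using g[of x y] by (simp add: insert_commute)
      then have "cut C P K m x y (rev (snd (A y x))) (rev (fst (A y x))) \<and>
          R x y = set (rev (snd (A y x))) \<and> R y x = set (rev (fst (A y x)))"
        using False cut_rev[OF p sym[OF xy] A[OF sym[OF xy]]] by (simp add: R_def)
      then show ?thesis by (intro exI)
    qed
  qed
qed

text \<open>The branch set of \<open>x\<close> is its core together with its parts of all paths at
  \<open>x\<close>. With \<open>D\<close> meaning two attached vertices on the path, the assumption
  on leaves is what the choice of an edge \<open>m x\<close> at every \<open>x\<close>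
  requires.\<close>

lemma full_state_model:
  assumes st: "state C E P K Iso U"
    and leaf: "\<And>l y. (l, y) \<in> E \<Longrightarrow> (\<forall>n. (l, n) \<in> E \<longrightarrow> n = y) \<Longrightarrow>
      \<exists>u v. u \<in> set (P l y) \<and> v \<in> set (P l y) \<and> attached C u \<and> attached C v \<and> u \<noteq> v"
  shows "\<exists>B. touching_model C B"
proof -
  note p = stateD(4)[OF st] and c = stateD(5)[OF st] and i = stateD(6)[OF st]
  define D where "D x y \<longleftrightarrow> (x, y) \<in> E \<and>
    (\<exists>u v. u \<in> set (P x y) \<and> v \<in> set (P x y) \<and> attached C u \<and> attached C v \<and> u \<noteq> v)" for x y
  have D_sym: "D y x" if "D x y" for x y
    using that pathsD(1,8)[OF p, of x y] by (auto simp: D_def)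
  have "\<exists>m. \<forall>x \<in> Field E. (x, m x) \<in> E \<and> (m (m x) = x \<longrightarrow> D x (m x))"
  proof (rule nonrepeating_choice[OF finite_E sym_E irrefl_E D_sym])
    show "D l y" if "(l, y) \<in> E" "\<forall>n. (l, n) \<in> E \<longrightarrow> n = y" for l y
      unfolding D_def using that(1) leaf[OF that] by (rule conjI)
  qed
  then obtain m where m: "\<And>x. x \<in> Field E \<Longrightarrow> (x, m x) \<in> E"
    and mm: "\<And>x. x \<in> Field E \<Longrightarrow> m (m x) = x \<Longrightarrow> D x (m x)" by blast
  obtain R where R: "\<And>x y. (x, y) \<in> E \<Longrightarrow> \<exists>a b. cut C P K m x y a b \<and> R x y = set a \<and> R y x = set b"
    using cuts_exist[OF st m mm[unfolded D_def, THEN conjunct2]] by blast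
  have sym: "(y, x) \<in> E" if "(x, y) \<in> E" for x y using that sym_E by (meson symD)
  have R_sub: "R x y \<subseteq> set (P x y)" if "(x, y) \<in> E" for x y
    using R[OF that] by (auto simp: cut_def)
  have R_disj: "R x y \<inter> R y x = {}" if "(x, y) \<in> E" for x y
    using R[OF that] pathsD(4)[OF p that] by (auto simp: cut_def)
  have R_conn: "R x y = {} \<or> conn (R x y) \<and> hd (P x y) \<in> R x y" if xy: "(x, y) \<in> E" for x y
  proof -
    obtain a b where ab: "P x y = a @ b" "R x y = set a" using R[OF xy] by (auto simp: cut_def)
    show ?thesis
    proof (cases "a = []")
      case False
      then have "conn (set a)" using pathsD(5)[OF p xy] ab by (intro conn_list) (auto simp: successively_append_iff)
      then show ?thesis using ab False by simp
    qed (use ab in simp)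
  qed
  have R_empty: "K x \<noteq> {}" if xy: "(x, y) \<in> E" "R x y = {}" for x y
    using R[OF xy(1)] xy(2) by (auto simp: cut_def)
  \<comment> \<open>A first vertex shared with another path stays with the label on its side:
    \<open>cut\<close> forbids that label's part to be empty in this case.\<close>
  have R_shared: "hd (P x y) \<in> R x y"
    if xy: "(x, y) \<in> E" and cd: "(c, d) \<in> E" "{c, d} \<noteq> {x, y}" "hd (P x y) \<in> set (P c d)" for x y c d
  proof -
    obtain a b where ab: "cut C P K m x y a b" "R x y = set a" using R[OF xy] by blast
    have "a \<noteq> []" using ab(1) cd unfolding cut_def by blast
    then have "R x y \<noteq> {}" using ab(2) by simp
    then show ?thesis using R_conn[OF xy] by blast
  qed
  define N where "N x = {y. (x, y) \<in> E}" for x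
  define B where "B x = (if x \<in> Iso then {U x} else K x \<union> (\<Union>y \<in> N x. R x y))" for x
  have nIso: "x \<notin> Iso" if "x \<in> Field E" for x using that Iso_E by blast
  have BF: "B x = K x \<union> (\<Union>y \<in> N x. R x y)" if "x \<in> Field E" for x using nIso[OF that] by (simp add: B_def)
  have Bi: "B x = {U x}" if "x \<in> Iso" for x using that by (simp add: B_def)
  have R_in: "R x y \<subseteq> B x" if "(x, y) \<in> E" for x y
    using BF[of x] that by (auto simp: N_def intro: FieldI1)
  have K_in: "K x \<subseteq> B x" if "x \<in> Field E" for x using BF[OF that] by blast
  have conn_F: "conn (B x)" if x: "x \<in> Field E" for x
  proof (cases "K x = {}")
    case True
    define h where "h = hd (P x (m x))"
    have h: "conn (R x y) \<and> h \<in> R x y" if "y \<in> N x" for y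
    proof -
      have xy: "(x, y) \<in> E" using that by (simp add: N_def)
      then have "R x y \<noteq> {}" using R_empty True by blast
      moreover have "hd (P x y) = h" using coresD(6)[OF c True xy m[OF x]] by (simp add: h_def)
      ultimately show ?thesis using R_conn[OF xy] by blast
    qed
    have "conn ({h} \<union> (\<Union>y \<in> N x. R x y))"
      by (rule conn_touching_Union) (use conn_singleton h in blast)+
    moreover have "{h} \<union> (\<Union>y \<in> N x. R x y) = B x"
      using BF[OF x] True h m[OF x] by (auto simp: N_def)
    ultimately show ?thesis by simp
  next
    case False
    have "conn (K x \<union> (\<Union>y \<in> N x. R x y))"
    proof (rule conn_touching_Union)
      show "conn (K x)" by (rule coresD(3)[OF c False])
      fix y assume "y \<in> N x"
      then have xy: "(x, y) \<in> E" by (simp add: N_def)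
      show "R x y = {} \<or> conn (R x y) \<and> (\<exists>a \<in> R x y. \<exists>k \<in> K x. a = k \<or> adj k a)"
        using R_conn[OF xy] coresD(7)[OF c False xy] by blast
    qed
    then show ?thesis using BF[OF x] by simp
  qed
  have att_F: "\<exists>a \<in> B x. attached C a" if x: "x \<in> Field E" for x
  proof -
    obtain a b where "cut C P K m x (m x) a b" "R x (m x) = set a" using R[OF m[OF x]] by blast
    then have "\<exists>u \<in> R x (m x). attached C u" by (simp add: cut_def)
    then show ?thesis using R_in[OF m[OF x]] by blast
  qed
  have sub_F: "B x \<subseteq> V - C" if x: "x \<in> Field E" for x
  proof -
    have "R x y \<subseteq> V - C" if "y \<in> N x" for y
    proof -
      have xy: "(x, y) \<in> E" using that by (simp add: N_def)
      show ?thesis using R_sub[OF xy] pathsD(6,7)[OF p xy] by blast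
    qed
    then show ?thesis using BF[OF x] coresD(1,2)[OF c, of x] by blast
  qed
  have RR: "R x y \<inter> R x' y' = {}" if xy: "(x, y) \<in> E" and xy': "(x', y') \<in> E" and "x \<noteq> x'" for x y x' y'
  proof (rule ccontr)
    assume "R x y \<inter> R x' y' \<noteq> {}"
    then obtain w where w: "w \<in> R x y" "w \<in> R x' y'" by blast
    have wP: "w \<in> set (P x y)" "w \<in> set (P x' y')" using w R_sub xy xy' by blast+
    show False
    proof (cases "{x, y} = {x', y'}")
      case True
      then have "x' = y" "y' = x" using \<open>x \<noteq> x'\<close> by (auto simp: doubleton_eq_iff)
      then show False using w R_disj[OF xy] by blast
    next
      case False
      \<comment> \<open>Different paths meet only in a common first vertex at a label
        \<open>l\<close>, and that vertex belongs to the part of \<open>l\<close> on both. Since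
        \<open>x\<close> and \<open>x'\<close> differ, one of them is not \<open>l\<close>, and its
        part of its path is disjoint from that of \<open>l\<close>.\<close>
      then obtain l m n where l: "{l, m} = {x, y}" "{l, n} = {x', y'}" "hd (P l m) = w" "hd (P l n) = w"
        using paths_meet[OF p xy xy' wP] by blast
      have lm: "(l, m) \<in> E" and ln: "(l, n) \<in> E" using set_paths_eq(2)[OF p] xy xy' l by blast+
      have wlm: "w \<in> set (P l m)" "w \<in> set (P l n)"
        using l(3,4) hd_in_set[OF pathsD(3)[OF p lm]] hd_in_set[OF pathsD(3)[OF p ln]] by metis+
      have ne: "{l, n} \<noteq> {l, m}" using False l(1,2) by metis
      have Rlm: "w \<in> R l m" using R_shared[OF lm ln ne] wlm l(3) by metis
      have Rln: "w \<in> R l n" using R_shared[OF ln lm] ne wlm l(4) by metis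
      show False
      proof (cases "x = l")
        case True
        then have "x' = n" "y' = l" using l(2) \<open>x \<noteq> x'\<close> by (auto simp: doubleton_eq_iff)
        then show False using w(2) Rln R_disj[OF ln] by blast
      next
        case False
        then have "x = m" "y = l" using l(1) by (auto simp: doubleton_eq_iff)
        then show False using w(1) Rlm R_disj[OF lm] by blast
      qed
    qed
  qed
  have KR: "K x \<inter> R x' y = {}" if "(x', y) \<in> E" for x x' y
    using coresD(5)[OF c that, of x] R_sub[OF that] by blast
  have disj_F: "B x \<inter> B x' = {}" if x: "x \<in> Field E" "x' \<in> Field E" "x \<noteq> x'" for x x'
  proof -
    have 1: "K x \<inter> K x' = {}" by (rule coresD(4)[OF c x(3)])
    have 2: "K x \<inter> (\<Union>y \<in> N x'. R x' y) = {}" "K x' \<inter> (\<Union>y \<in> N x. R x y) = {}"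
      using KR by (auto simp: N_def)
    have 3: "(\<Union>y \<in> N x. R x y) \<inter> (\<Union>y \<in> N x'. R x' y) = {}"
    proof -
      have "R x y \<inter> R x' y' = {}" if "y \<in> N x" "y' \<in> N x'" for y y'
        using RR[of x y x' y'] that x(3) by (simp add: N_def)
      then show ?thesis by blast
    qed
    show ?thesis unfolding BF[OF x(1)] BF[OF x(2)] using 1 2 3 by blast
  qed
  have disj_i: "U z \<notin> B x" if x: "x \<in> Field E" and z: "z \<in> Iso" for x z
  proof -
    have "U z \<notin> K x" using isosD(5)[OF i, of x] z by blast
    moreover have "U z \<notin> R x y" if "y \<in> N x" for y
    proof -
      have xy: "(x, y) \<in> E" using that by (simp add: N_def)
      show ?thesis using isosD(6)[OF i xy] R_sub[OF xy] z by blast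
    qed
    ultimately show ?thesis using BF[OF x] by blast
  qed
  have "disjoint_family_on B (Field E \<union> Iso)"
    unfolding disjoint_family_on_def
  proof (intro ballI impI)
    fix x x' assume x: "x \<in> Field E \<union> Iso" "x' \<in> Field E \<union> Iso" "x \<noteq> x'"
    consider "x \<in> Field E" "x' \<in> Field E" | "x \<in> Field E" "x' \<in> Iso" | "x \<in> Iso" "x' \<in> Field E" | "x \<in> Iso" "x' \<in> Iso"
      using x by blast
    then show "B x \<inter> B x' = {}"
    proof cases
      case 1 then show ?thesis using disj_F x(3) by blast
    next
      case 2 then show ?thesis using disj_i Bi by auto
    next
      case 3 then show ?thesis using disj_i Bi by auto
    next
      case 4 then show ?thesis using isosD(2)[OF i] x(3) Bi by (auto simp: inj_on_def)
    qed
  qed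
  \<comment> \<open>The two parts of \<open>P x y\<close> are adjacent at the cut; for an empty part
    the core, which is next to the end of the path, takes over.\<close>
  moreover have "\<exists>a \<in> B x. \<exists>b \<in> B y. adj a b" if xy: "(x, y) \<in> E" for x y
  proof -
    have x: "x \<in> Field E" and y: "y \<in> Field E" using xy by (auto intro: FieldI1 FieldI2)
    obtain a b where ab: "P x y = a @ b" "R x y = set a" "R y x = set b" using R[OF xy] by (auto simp: cut_def)
    consider "a = []" | "b = []" | "a \<noteq> []" "b \<noteq> []" by blast
    then show ?thesis
    proof cases
      case 1
      then obtain k where "k \<in> K x" "adj k (hd (P x y))"
        using coresD(7)[OF c R_empty[OF xy] xy] ab by auto
      moreover have "hd (P x y) \<in> R y x" using 1 ab pathsD(3)[OF p xy] by auto
      ultimately show ?thesis using K_in[OF x] R_in[OF sym[OF xy]] by blast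
    next
      case 2
      then obtain k where k: "k \<in> K y" "adj k (hd (P y x))"
        using coresD(7)[OF c R_empty[OF sym[OF xy]] sym[OF xy]] ab by auto
      have "hd (P y x) \<in> set (P y x)" using pathsD(3)[OF p sym[OF xy]] by simp
      then have "hd (P y x) \<in> R x y" using 2 ab pathsD(8)[OF p xy] by simp
      then show ?thesis using k K_in[OF y] R_in[OF xy] adj_sym by blast
    next
      case 3
      then have "adj (last a) (hd b)" using pathsD(5)[OF p xy] ab by (simp add: successively_append_iff)
      moreover have "last a \<in> R x y" "hd b \<in> R y x" using 3 ab by auto
      ultimately show ?thesis using R_in[OF xy] R_in[OF sym[OF xy]] by blast
    qed
  qed
  moreover have "conn (B x) \<and> B x \<subseteq> V - C \<and> (\<exists>a \<in> B x. attached C a)" if "x \<in> Field E \<union> Iso" for x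
  proof (cases "x \<in> Field E")
    case True then show ?thesis using conn_F sub_F att_F by blast
  next
    case False
    then have x: "x \<in> Iso" using that by blast
    have "U x \<in> V" "U x \<notin> C" using isosD(3,4)[OF i] x by blast+
    then show ?thesis using Bi[OF x] stateD(9)[OF st x] conn_singleton by simp
  qed
  ultimately have "touching_model C B" using stateD(1,2)[OF st] by (simp add: touching_model_def)
  then show ?thesis by (rule exI[of "touching_model C" B])
qed

text \<open>A state that realises everything either yields a model or has a leaf edge whose path has
  only one attached vertex; that edge can be re-realised.\<close>

lemma good_progress:
  assumes "good C" and no: "\<not> (\<exists>C B. touching_model C B)"
  shows "\<exists>Q. progress C Q"
proof -
  obtain F P K I U where st: "state C F P K I U" using assms(1) by (auto simp: good_def)
  note p = stateD(4)[OF st] and i = stateD(6)[OF st]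
  consider y z where "(y, z) \<in> E" "(y, z) \<notin> F" | j where "j \<in> Iso" "j \<notin> I" | "E \<subseteq> F" "Iso \<subseteq> I"
    by (metis subrelI subsetI)
  then show ?thesis
  proof cases
    case 1 then show ?thesis by (rule progress_edge[OF st])
  next
    case 2 then show ?thesis by (rule progress_iso[OF st])
  next
    case 3
    then have "F = E" "I = Iso" using pathsD_sub(1)[OF p] isosD(1)[OF i] by blast+
    then have stE: "state C E P K Iso U" using st by simp
    have "\<not> (\<forall>l y. (l, y) \<in> E \<longrightarrow> (\<forall>n. (l, n) \<in> E \<longrightarrow> n = y) \<longrightarrow>
      (\<exists>u v. u \<in> set (P l y) \<and> v \<in> set (P l y) \<and> attached C u \<and> attached C v \<and> u \<noteq> v))"
      using full_state_model[OF stE] no by blast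
    then obtain l y where ly: "(l, y) \<in> E" "\<And>n. (l, n) \<in> E \<Longrightarrow> n = y"
      "\<And>u v. u \<in> set (P l y) \<Longrightarrow> v \<in> set (P l y) \<Longrightarrow> attached C u \<Longrightarrow> attached C v \<Longrightarrow> u = v" by blast
    have "(y, l) \<in> E" using ly(1) sym_E by (meson symD)
    then show ?thesis by (rule progress_single[OF stE _ ly(2,3)])
  qed
qed

end

section \<open>The vertex order\<close>

context sym_rel
begin

definition component :: "'a set \<Rightarrow> 'a set \<Rightarrow> bool" where
  "component D X \<longleftrightarrow> conn D \<and> D \<subseteq> X \<and> (\<forall>u \<in> X. attached D u \<longrightarrow> u \<in> D)"

lemma closed_walk:
  assumes closed: "\<forall>u \<in> X. attached D u \<longrightarrow> u \<in> D"
  shows "w \<in> D \<Longrightarrow> successively adj (w # p) \<Longrightarrow> set p \<subseteq> X \<Longrightarrow> set p \<subseteq> D"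
proof (induction p arbitrary: w)
  case (Cons a p)
  have "adj a w" using Cons.prems(2) adj_sym by simp
  then have "a \<in> D" using closed Cons.prems by (auto simp: attached_def)
  then show ?case using Cons by simp
qed simp

lemma conn_subset_closed:
  assumes "conn D" "D \<subseteq> X" and closed: "\<forall>u \<in> X. attached C u \<longrightarrow> u \<in> C" and w: "w \<in> D" "w \<in> C"
  shows "D \<subseteq> C"
proof
  fix u assume "u \<in> D"
  then have "(w, u) \<in> (arcs_in D)\<^sup>*" using assms(1) w by (simp add: conn_def)
  then obtain p where p: "p \<noteq> []" "hd p = w" "last p = u" "set p \<subseteq> D" "successively adj p"
    using rtrancl_arcs_in_list w by blast
  then obtain s where s: "p = w # s" by (cases p) auto
  have "set s \<subseteq> C" by (rule closed_walk[OF closed w(2)]) (use p s assms(2) in auto)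
  then show "u \<in> C" using p(1,3) s w by (auto split: if_splits)
qed

lemma component_exists:
  assumes "w \<in> X"
  obtains C where "component C X" "w \<in> C"
proof -
  define C where "C = {u. (w, u) \<in> (arcs_in X)\<^sup>*}"
  have wC: "w \<in> C" by (simp add: C_def)
  have CX: "C \<subseteq> X"
  proof
    fix u assume "u \<in> C"
    then have "(w, u) \<in> (arcs_in X)\<^sup>*" by (simp add: C_def)
    then show "u \<in> X" using assms by (induction rule: rtrancl_induct) (auto simp: arcs_in_def)
  qed
  have step: "u \<in> C" if "c \<in> C" "adj c u" "u \<in> X" for c u
  proof -
    have "(c, u) \<in> arcs_in X" using that CX by (auto simp: arcs_in_def)
    then show ?thesis using that(1) by (auto simp: C_def intro: rtrancl_into_rtrancl)
  qed
  have "conn C"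
  proof (rule conn_hubI[OF wC])
    fix u assume "u \<in> C"
    then have "(w, u) \<in> (arcs_in X)\<^sup>*" by (simp add: C_def)
    then have "u \<in> C \<and> (w, u) \<in> (arcs_in C)\<^sup>*"
    proof (induction rule: rtrancl_induct)
      case base then show ?case using wC by simp
    next
      case (step y z)
      then have "z \<in> C" using \<open>(y, z) \<in> arcs_in X\<close> \<open>\<And>u c. c \<in> C \<Longrightarrow> adj c u \<Longrightarrow> u \<in> X \<Longrightarrow> u \<in> C\<close>
        by (auto simp: arcs_in_def)
      moreover have "(y, z) \<in> arcs_in C" using step calculation by (auto simp: arcs_in_def)
      ultimately show ?case using step by (auto intro: rtrancl_into_rtrancl)
    qed
    then show "(w, u) \<in> (arcs_in C)\<^sup>*" by simp
  qed
  moreover have "u \<in> C" if "u \<in> X" "attached C u" for u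
    using that step adj_sym by (auto simp: attached_def)
  ultimately have "component C X" using CX by (auto simp: component_def)
  then show thesis using wC by (rule that)
qed

text \<open>
  The vertices counted by the colouring number when only \<open>X\<close> has been ordered, by \<open>L\<close>, and all
  other vertices come before \<open>X\<close>.
\<close>

definition sreach :: "nat \<Rightarrow> 'a set \<Rightarrow> 'a rel \<Rightarrow> 'a \<Rightarrow> 'a set" where
  "sreach r X L w = {u. (u \<notin> X \<or> (u, w) \<in> L) \<and>
    (u = w \<or> (\<exists>p. successively adj (w # p @ [u]) \<and> set p \<subseteq> {z \<in> X. (w, z) \<in> L \<and> z \<noteq> w} \<and> length p < r))}"

lemma finite_sreach: "finite (sreach r X L w)"
proof (rule finite_subset)
  show "sreach r X L w \<subseteq> insert w V"
    by (auto simp: sreach_def successively_append_iff successively_Cons intro: adj_V2)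
qed (simp add: finite_V)

end

lemma linear_order_on_prepend:
  assumes Q: "linear_order_on Q A" and Y: "linear_order_on Y B" and "Q \<inter> Y = {}"
  shows "linear_order_on (Q \<union> Y) (A \<union> B \<union> Q \<times> Y)"
proof -
  have A: "A \<subseteq> Q \<times> Q" "refl_on Q A" "trans A" "antisym A" "total_on Q A"
    and B: "B \<subseteq> Y \<times> Y" "refl_on Y B" "trans B" "antisym B" "total_on Y B"
    using Q Y by (auto simp: order_on_defs)
  have "trans (A \<union> B \<union> Q \<times> Y)"
  proof (rule transI)
    fix x y z assume "(x, y) \<in> A \<union> B \<union> Q \<times> Y" "(y, z) \<in> A \<union> B \<union> Q \<times> Y"
    then show "(x, z) \<in> A \<union> B \<union> Q \<times> Y"
      using A(1) B(1) transD[OF A(3), of x y z] transD[OF B(3), of x y z] assms(3) by blast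
  qed
  moreover have "antisym (A \<union> B \<union> Q \<times> Y)"
  proof (rule antisymI)
    fix x y assume "(x, y) \<in> A \<union> B \<union> Q \<times> Y" "(y, x) \<in> A \<union> B \<union> Q \<times> Y"
    then show "x = y"
      using A(1) B(1) antisymD[OF A(4), of x y] antisymD[OF B(4), of x y] assms(3) by blast
  qed
  moreover have "total_on (Q \<union> Y) (A \<union> B \<union> Q \<times> Y)"
    using A(5) B(5) unfolding total_on_def by blast
  moreover have "refl_on (Q \<union> Y) (A \<union> B \<union> Q \<times> Y)"
    using A(2) B(2) unfolding refl_on_def by blast
  moreover have "A \<union> B \<union> Q \<times> Y \<subseteq> (Q \<union> Y) \<times> (Q \<union> Y)" using A(1) B(1) by blast
  ultimately show ?thesis by (simp add: order_on_defs)
qed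

context guarding
begin

text \<open>The start of the construction: no vertex outside a component of the whole graph is
  attached to it, so the empty model covers.\<close>

lemma good_component:
  assumes "component D V" shows "good D"
proof -
  have D: "conn D" "D \<subseteq> V" "\<forall>u \<in> V. attached D u \<longrightarrow> u \<in> D" using assms by (auto simp: component_def)
  have "paths D {} P" for P by (simp add: paths_def shape_def meets_def guarded_def sym_def)
  moreover have "cores D {} P (\<lambda>_. {})" for P by (simp add: cores_def)
  moreover have "isos D {} P (\<lambda>_. {}) {} U" for P U by (simp add: isos_def)
  moreover have cov: "covers D {} P {} U" for P U unfolding covers_def using D(3) by blast
  ultimately have "state D {} P (\<lambda>_. {}) {} U" for P U
    using D(1,2) by (simp add: state_def model_def has_private_def cov)
  then show ?thesis unfolding good_def by blast
qed

text \<open>\<open>X\<close> is the set of vertices not yet ordered. A set \<open>Q\<close> that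
  makes progress in one component is put before the rest of \<open>X\<close>; the other components
  are untouched, and those inside \<open>C - Q\<close> are good by \<open>progress\<close>.\<close>

lemma good_order:
  assumes no: "\<not> (\<exists>C B. touching_model C B)"
  shows "X \<subseteq> V \<Longrightarrow> (\<forall>D. component D X \<longrightarrow> good D) \<Longrightarrow>
    \<exists>L. linear_order_on X L \<and> (\<forall>w \<in> X. card (sreach r X L w) \<le> bound)"
proof (induction "card X" arbitrary: X rule: less_induct)
  case less
  show ?case
  proof (cases "X = {}")
    case True
    then show ?thesis by (intro exI[of _ "{}"]) (simp add: order_on_defs refl_on_def total_on_def)
  next
    case False
    then obtain w0 where "w0 \<in> X" by blast
    then obtain C where C: "component C X" by (rule component_exists)
    then have C': "conn C" "C \<subseteq> X" "\<forall>u \<in> X. attached C u \<longrightarrow> u \<in> C" by (auto simp: component_def)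
    obtain Q where "progress C Q" using good_progress[OF _ no] less.prems(2) C by blast
    then have Q: "Q \<noteq> {}" "Q \<subseteq> C"
      "\<And>w. w \<in> Q \<Longrightarrow> card ((reach r C w - C) \<union> (Q \<inter> insert w (reach r C w))) \<le> bound"
      "\<And>D. conn D \<Longrightarrow> D \<subseteq> C - Q \<Longrightarrow> (\<forall>u \<in> C - Q. attached D u \<longrightarrow> u \<in> D) \<Longrightarrow> good D"
      unfolding progress_def by blast+
    have finX: "finite X" using less.prems(1) finite_V by (rule finite_subset)
    let ?Y = "X - Q"
    have "card ?Y < card X" using Q C' finX by (intro psubset_card_mono) blast+
    moreover have "good D" if D: "component D ?Y" for D
    proof -
      have D': "conn D" "D \<subseteq> ?Y" "\<forall>u \<in> ?Y. attached D u \<longrightarrow> u \<in> D" using D by (auto simp: component_def)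
      show ?thesis
      proof (cases "D \<inter> C = {}")
        case True
        have "u \<in> D" if u: "u \<in> X" "attached D u" for u
        proof (cases "u \<in> Q")
          case True
          obtain d where d: "d \<in> D" "adj u d" using u by (auto simp: attached_def)
          then have "attached C d" using True Q(2) adj_sym by (auto simp: attached_def)
          then have "d \<in> C" using C'(3) d D'(2) by blast
          then show ?thesis using d \<open>D \<inter> C = {}\<close> by blast
        next
          case False then show ?thesis using D'(3) u by blast
        qed
        then have "component D X" using D' by (auto simp: component_def)
        then show ?thesis using less.prems(2) by blast
      next
        case False
        then obtain w where w: "w \<in> D" "w \<in> C" by blast
        have "D \<subseteq> C" by (rule conn_subset_closed[OF D'(1) _ C'(3) w]) (use D'(2) in blast)
        then show ?thesis using Q(4)[OF D'(1)] D'(2,3) C'(2) by blast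
      qed
    qed
    ultimately obtain L' where L': "linear_order_on ?Y L'" "\<And>w. w \<in> ?Y \<Longrightarrow> card (sreach r ?Y L' w) \<le> bound"
      using less.hyps[of ?Y] less.prems(1) by blast
    \<comment> \<open>Any linear order of \<open>Q\<close> will do.\<close>
    obtain A where "well_order_on Q A" using well_order_on by blast
    then have A: "linear_order_on Q A" by (simp add: well_order_on_def)
    define L where "L = A \<union> L' \<union> Q \<times> ?Y"
    have QX: "Q \<subseteq> X" using Q(2) C'(2) by blast
    have "linear_order_on (Q \<union> ?Y) L" unfolding L_def by (rule linear_order_on_prepend[OF A L'(1)]) blast
    moreover have "Q \<union> ?Y = X" using QX by blast
    ultimately have lin: "linear_order_on X L" by simp
    have AQ: "A \<subseteq> Q \<times> Q" and LY: "L' \<subseteq> ?Y \<times> ?Y" using A L'(1) by (auto simp: order_on_defs)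
    have "card (sreach r X L w) \<le> bound" if w: "w \<in> X" for w
    proof (cases "w \<in> Q")
      case False
      have below: "(u, w) \<in> L' \<or> u \<notin> ?Y" if "(u, w) \<in> L" for u using that AQ False by (auto simp: L_def)
      have above: "z \<in> ?Y \<and> (w, z) \<in> L'" if "(w, z) \<in> L" for z using that AQ LY False by (auto simp: L_def)
      \<comment> \<open>For a later vertex nothing changes: \<open>Q\<close> lies below it, and with
        respect to \<open>X - Q\<close> it counts as already ordered.\<close>
      have "sreach r X L w \<subseteq> sreach r ?Y L' w"
      proof
        fix u assume u: "u \<in> sreach r X L w"
        then have "u \<notin> ?Y \<or> (u, w) \<in> L'" using below by (auto simp: sreach_def)
        moreover have "{z \<in> X. (w, z) \<in> L \<and> z \<noteq> w} \<subseteq> {z \<in> ?Y. (w, z) \<in> L' \<and> z \<noteq> w}" using above by blast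
        then have "u = w \<or> (\<exists>p. successively adj (w # p @ [u]) \<and>
            set p \<subseteq> {z \<in> ?Y. (w, z) \<in> L' \<and> z \<noteq> w} \<and> length p < r)"
          using u unfolding sreach_def by blast
        ultimately show "u \<in> sreach r ?Y L' w" by (simp only: sreach_def mem_Collect_eq simp_thms)
      qed
      then have "card (sreach r X L w) \<le> card (sreach r ?Y L' w)" by (intro card_mono finite_sreach)
      then show ?thesis using L'(2)[of w] w False by simp
    next
      case True
      \<comment> \<open>Inner vertices lie in \<open>X\<close>, so the walk cannot leave the
        component \<open>C\<close>. An end in \<open>C\<close> that is at most \<open>w\<close> must
        be in \<open>Q\<close>, because the rest of \<open>X\<close> comes later.\<close>
      have "sreach r X L w \<subseteq> (reach r C w - C) \<union> (Q \<inter> insert w (reach r C w))"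
      proof
        fix u assume u: "u \<in> sreach r X L w"
        show "u \<in> (reach r C w - C) \<union> (Q \<inter> insert w (reach r C w))"
        proof (cases "u = w")
          case False
          then obtain p where p: "successively adj (w # p @ [u])" "set p \<subseteq> X" "length p < r"
            using u unfolding sreach_def by blast
          have "successively adj (w # p)"
            using p(1) successively_append_iff[of adj "w # p" "[u]"] by simp
          then have "set p \<subseteq> C" using closed_walk[OF C'(3)] True Q(2) p(2) by blast
          then have r: "u \<in> reach r C w" using p by (auto simp: reach_def)
          have "u \<in> Q" if "u \<in> C"
          proof -
            have "(u, w) \<in> L" using u that C'(2) by (auto simp: sreach_def)
            then show ?thesis using True AQ LY by (auto simp: L_def)
          qed
          then show ?thesis using r by blast
        qed (use True in blast)
      qed
      moreover have "finite ((reach r C w - C) \<union> (Q \<inter> insert w (reach r C w)))"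
        using finite_subset[OF reach_subset_V finite_V] finite_subset[OF QX finX] by blast
      ultimately show ?thesis using Q(3)[OF True] by (meson card_mono le_trans)
    qed
    then show ?thesis using lin by blast
  qed
qed

lemma order_exists:
  assumes "\<not> (\<exists>C B. touching_model C B)"
  shows "\<exists>L. linear_order_on V L \<and> (\<forall>w \<in> V. card (sreach r V L w) \<le> bound)"
  by (rule good_order[OF assms]) (use good_component in auto)

end

section \<open>Transfer to the digraph formulation and conclusion\<close>

lemma graph_sym_rel:
  assumes "graph G"
  shows "sym_rel (verts G) (\<lambda>a b. a \<rightarrow>\<^bsub>G\<^esub> b)"
proof -
  interpret graph G by fact
  show ?thesis
  proof
    show "finite (verts G)" by simp
    show "b \<rightarrow>\<^bsub>G\<^esub> a" if "a \<rightarrow>\<^bsub>G\<^esub> b" for a b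
      using sym_arcs that by (auto simp: symmetric_def sym_def)
    show "a \<in> verts G" if "a \<rightarrow>\<^bsub>G\<^esub> b" for a b using that by (auto simp: arcs_ends_def arc_to_ends_def)
  qed
qed

lemma conn_connected:
  assumes "graph G" and B: "sym_rel.conn (\<lambda>a b. a \<rightarrow>\<^bsub>G\<^esub> b) B" "B \<subseteq> verts G"
  shows "connected (G \<restriction> B)"
proof -
  interpret graph G by fact
  interpret S: sym_rel "verts G" "\<lambda>a b. a \<rightarrow>\<^bsub>G\<^esub> b" by (rule graph_sym_rel) fact
  interpret GB: wf_digraph "G \<restriction> B" by (rule wellformed_induce_subgraph)
  have conn: "S.conn B" by fact
  show ?thesis
  proof (rule GB.connectedI)
    show "verts (G \<restriction> B) \<noteq> {}" using conn by (simp add: S.conn_def)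
    fix u w assume uw: "u \<in> verts (G \<restriction> B)" "w \<in> verts (G \<restriction> B)"
    then have "(u, w) \<in> (S.arcs_in B)\<^sup>*" using conn by (simp add: S.conn_def)
    then have "u \<rightarrow>\<^sup>*\<^bsub>G \<restriction> B\<^esub> w"
    proof (induction rule: rtrancl_induct)
      case base then show ?case using uw by (intro GB.reachable_refl)
    next
      case (step y z)
      then have "y \<in> B" "z \<in> B" "y \<rightarrow>\<^bsub>G\<^esub> z" by (auto simp: S.arcs_in_def)
      then have "y \<rightarrow>\<^bsub>G \<restriction> B\<^esub> z"
        by (auto simp: arcs_ends_def arc_to_ends_def image_iff)
      then show ?case using step.IH GB.reachable_adj_trans by blast
    qed
    then show "u \<rightarrow>\<^sup>*\<^bsub>with_proj (mk_symmetric (G \<restriction> B))\<^esub> w" by (rule GB.reachable_mk_symmetricI)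
  qed
qed

theorem theorem1p2:
  fixes H :: "('c, 'd) pre_digraph" and G :: "('a, 'b) pre_digraph" and v :: 'c and r :: nat
  assumes "graph H" and "v \<in> verts H"
    and "graph G" and "\<not> is_minor H G"
    and "r > 0"
  shows "col r G \<le> card (edges (pre_digraph.del_vert H v)) * (2 * r + 1)
                    + card (isolated_verts (pre_digraph.del_vert H v))"
proof -
  interpret H: graph H by fact
  interpret G: graph G by fact
  let ?H = "H.del_vert v"
  let ?adj = "\<lambda>a b. a \<rightarrow>\<^bsub>G\<^esub> b"
  define E where "E = {(x, y). x \<rightarrow>\<^bsub>?H\<^esub> y}"
  define Iso where "Iso = isolated_verts ?H"
  have arcs: "x \<rightarrow>\<^bsub>?H\<^esub> y \<longleftrightarrow> x \<rightarrow>\<^bsub>H\<^esub> y \<and> x \<noteq> v \<and> y \<noteq> v" for x y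
    by (auto simp: H.del_vert_def arcs_ends_def arc_to_ends_def image_iff)
  have H_sym: "y \<rightarrow>\<^bsub>H\<^esub> x" if "x \<rightarrow>\<^bsub>H\<^esub> y" for x y
    using H.sym_arcs that by (auto simp: symmetric_def sym_def)
  have H_loop: "\<not> x \<rightarrow>\<^bsub>H\<^esub> x" for x using H.no_loops by (auto simp: arcs_ends_def arc_to_ends_def)
  have H_verts: "x \<in> verts H" if "x \<rightarrow>\<^bsub>H\<^esub> y" for x y
    using that by (auto simp: arcs_ends_def arc_to_ends_def)
  have symE: "sym E" using H_sym by (auto simp: sym_def E_def arcs)
  have vertsH: "verts ?H = verts H - {v}" by (simp add: H.del_vert_def)
  \<comment> \<open>Every vertex of H other than v therefore receives a branch set.\<close>
  have fields: "Field E \<union> Iso = verts H - {v}"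
    using H_verts H_sym unfolding Iso_def isolated_verts_def vertsH E_def Field_def
    by (auto simp: arcs)
  interpret S: guarding "verts G" ?adj E Iso r
  proof (intro guarding.intro graph_sym_rel guarding_axioms.intro)
    show "graph G" by fact
    have "E \<subseteq> verts H \<times> verts H" using H_verts H_sym by (auto simp: E_def arcs)
    then show "finite E" by (rule finite_subset) simp
    show "sym E" by (rule symE)
    show "(x, x) \<notin> E" for x using H_loop by (simp add: E_def arcs)
    have "Iso \<subseteq> verts H" by (auto simp: Iso_def isolated_verts_def vertsH)
    then show "finite Iso" by (rule finite_subset) simp
    show "0 < r" by fact
    show "Iso \<inter> Field E = {}"
      using symE by (auto simp: Iso_def isolated_verts_def Field_def E_def sym_def)
  qed
  have bound: "S.bound = card (edges ?H) * (2 * r + 1) + card (isolated_verts ?H)"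
  proof -
    have ue: "S.uedges E = edges ?H" by (simp only: S.uedges_def edges_def) (simp add: E_def)
    show ?thesis unfolding S.bound_def ue unfolding Iso_def by (rule refl)
  qed
  have "\<not> (\<exists>C B. S.touching_model C B)"
  proof
    assume "\<exists>C B. S.touching_model C B"
    then obtain C B where t: "S.touching_model C B" by blast
    have C: "S.conn C" "C \<subseteq> verts G" using t by (simp_all add: S.touching_model_def)
    have B: "S.conn (B x)" "B x \<subseteq> verts G - C" "\<exists>a \<in> B x. \<exists>c \<in> C. a \<rightarrow>\<^bsub>G\<^esub> c" if "x \<in> verts H" "x \<noteq> v" for x
    proof -
      have "x \<in> Field E \<union> Iso" using fields that by blast
      then show "S.conn (B x)" "B x \<subseteq> verts G - C" "\<exists>a \<in> B x. \<exists>c \<in> C. a \<rightarrow>\<^bsub>G\<^esub> c"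
        using t unfolding S.touching_model_def S.attached_def by blast+
    qed
    have disj: "B x \<inter> B y = {}" if "x \<in> verts H - {v}" "y \<in> verts H - {v}" "x \<noteq> y" for x y
      using t that unfolding S.touching_model_def fields disjoint_family_on_def by blast
    have E: "\<exists>a \<in> B x. \<exists>b \<in> B y. a \<rightarrow>\<^bsub>G\<^esub> b" if "(x, y) \<in> E" for x y
      using t that unfolding S.touching_model_def by blast
    \<comment> \<open>The branch set of v is \<open>C\<close> itself.\<close>
    let ?B = "B(v := C)"
    have "is_minor H G"
      unfolding is_minor_def
    proof (intro exI[of _ ?B] conjI ballI allI impI)
      fix x assume x: "x \<in> verts H"
      show "?B x \<subseteq> verts G" using B(2)[OF x] C(2) by (cases "x = v") auto
      show "connected (G \<restriction> ?B x)"
        by (rule conn_connected) (use B(1,2)[OF x] C \<open>graph G\<close> in \<open>cases "x = v"; auto\<close>)+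
    next
      show "disjoint_family_on ?B (verts H)"
        unfolding disjoint_family_on_def
      proof (intro ballI impI)
        fix x y assume "x \<in> verts H" "y \<in> verts H" "x \<noteq> y"
        then show "?B x \<inter> ?B y = {}"
          using disj[of x y] B(2)[of x] B(2)[of y] by (cases "x = v"; cases "y = v") auto
      qed
    next
      fix x y assume xy: "x \<rightarrow>\<^bsub>H\<^esub> y"
      have xH: "x \<in> verts H" "y \<in> verts H" using H_verts[OF xy] H_verts[OF H_sym[OF xy]] by auto
      have neq: "x \<noteq> y" using xy H_loop by blast
      consider "x = v" "y \<noteq> v" | "y = v" "x \<noteq> v" | "x \<noteq> v" "y \<noteq> v" using neq by blast
      then show "\<exists>a \<in> ?B x. \<exists>b \<in> ?B y. a \<rightarrow>\<^bsub>G\<^esub> b"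
      proof cases
        case 1 then show ?thesis using B(3)[OF xH(2)] S.adj_sym by simp blast
      next
        case 2 then show ?thesis using B(3)[OF xH(1)] by simp
      next
        case 3 then show ?thesis using E[of x y] xy by (simp add: E_def arcs)
      qed
    qed
    then show False using \<open>\<not> is_minor H G\<close> by blast
  qed
  then obtain L where L: "linear_order_on (verts G) L"
    and card: "\<And>w. w \<in> verts G \<Longrightarrow> card (S.sreach r (verts G) L w) \<le> S.bound"
    using S.order_exists by blast
  have sub: "SReach r G L w \<subseteq> S.sreach r (verts G) L w" for w
  proof
    fix u assume "u \<in> SReach r G L w"
    then obtain p where u: "u \<in> verts G" "(u, w) \<in> L" and p: "vpath p G" "hd p = w" "last p = u"
      "vwalk_length p \<le> r" "\<And>z. z \<in> set (butlast (tl p)) \<Longrightarrow> (w, z) \<in> L \<and> w \<noteq> z"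
      unfolding SReach_def by blast
    have walk: "set p \<subseteq> verts G" "set (vwalk_arcs p) \<subseteq> arcs_ends G" "p \<noteq> []"
      using p(1) by (auto simp: vpath_def vwalk_def)
    have suc: "successively ?adj p"
      using walk(2) by (induction p rule: vwalk_arcs.induct) auto
    show "u \<in> S.sreach r (verts G) L w"
    \<comment> \<open>The path of length 0 is treated apart, because a walk
      \<open>w # p @ [u]\<close> has at least one edge. Otherwise at most \<open>r\<close> edges
      leave fewer than \<open>r\<close> inner vertices.\<close>
    proof (cases "u = w")
      case True then show ?thesis using u by (simp add: S.sreach_def)
    next
      case False
      obtain s where s: "p = w # s" using p(2) walk(3) by (cases p) auto
      then have "s \<noteq> []" "last s = u" using p(3) False by (auto split: if_splits)
      then have s': "s = butlast s @ [u]" by (metis append_butlast_last_id)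
      then have "length s = length (butlast s) + 1" by (metis length_append_singleton Suc_eq_plus1)
      then have "length (butlast s) < r" using p(4) s by simp
      moreover have "successively ?adj (w # butlast s @ [u])" using suc s s' by simp
      moreover have "set (butlast s) \<subseteq> {z \<in> verts G. (w, z) \<in> L \<and> z \<noteq> w}"
        using p(5) walk(1) s by (auto dest: in_set_butlastD)
      ultimately show ?thesis using u by (auto simp: S.sreach_def)
    qed
  qed
  have le: "card (SReach r G L w) \<le> S.bound" if "w \<in> verts G" for w
    using card_mono[OF S.finite_sreach sub] card[OF that] by (rule le_trans)
  \<comment> \<open>For the graph without vertices the supremum of the empty set is 0; the rule for
    bounding a supremum requires a nonempty index set.\<close>
  have sup: "(SUP w \<in> verts G. card (SReach r G L w)) \<le> S.bound"
  proof (cases "verts G = {}")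
    case False then show ?thesis using le by (intro cSUP_least)
  qed simp
  have fin: "finite {SUP w \<in> verts G. card (SReach r G L w) | L. linear_order_on (verts G) L}"
  proof -
    have "{L. linear_order_on (verts G) L} \<subseteq> Pow (verts G \<times> verts G)" by (auto simp: order_on_defs)
    then have "finite {L. linear_order_on (verts G) L}" by (rule finite_subset) simp
    then show ?thesis by (simp add: setcompr_eq_image)
  qed
  have "col r G \<le> (SUP w \<in> verts G. card (SReach r G L w))"
    unfolding col_def by (rule Min_le[OF fin]) (use L in blast)
  also have "\<dots> \<le> S.bound" by (rule sup)
  finally show ?thesis unfolding bound .
qed

end
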